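(* Let $S$ be a Boolean inverse monoid. Then $\mathsf{Etale}(S)$ is an étale Boolean right restriction monoid whose semigroup of partial units is isomorphic to $S$.
   Context: A right restriction semigroup is a semigroup $S$ with a unary operation $a\mapsto a^*$ satisfying: (RR1) $(s^* )^*=s^*$; (RR2) $(s^*t^* )^*=s^*t^*$; (RR3) $s^*t^*=t^*s^*$; (RR4) $ss^*=s$; (RR5) $(st)^*=(s^*t)^*$; (RR6) $t^*s=s(ts)^*$. Elements with $a^*=a$ are projections; $\mathsf{Proj}(S)$ is the set of them. The natural partial order is $a\le b$ iff $a=ba^*$; joins refer to it. Elements $a,b$ are left-compatible, $a\sim_l b$, if $ab^*=ba^*$; a set is left-compatible if its elements are pairwise so. A right restriction monoid is complete if every left-compatible subset has a join and $(\bigvee_i a_i)b=\bigvee_i a_ib$ for all such joins. It is Boolean if every pair of left-compatible elements has a join, multiplication distributes from the right over such binary joins, and $\mathsf{Proj}(S)$ is a Boolean algebra whose bottom $0$ is the zero of the monoid. An element $a$ is a partial unit if there is $b$ with $ba=a^*$ and $ab=b^*$; $\mathsf{Inv}(S)$ is the set of partial units (an inverse semigroup). A Boolean right restriction monoid is étale if every element is a join of a finite number of partial units. An inverse monoid is a right restriction monoid with $a^*=a^{-1}a$. In it, $a,b$ are compatible if $ab^{-1}$ and $a^{-1}b$ are idempotents. A Boolean inverse monoid is an inverse monoid with zero in which every pair of compatible elements has a join, multiplication distributes over such joins, and the idempotents form a Boolean algebra. Construction of $\mathsf{Etale}(S)$ (the companion of $S$) for a Boolean inverse monoid $S$: a subset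 of $S$ is acceptable if it is a left-compatible order ideal (down-closed set). $\mathsf{R}(S)$ is the set of all acceptable subsets; under $AB=\{ab: a\in A,b\in B\}$ and $A^*=\{a^*:a\in A\}$ it is a complete right restriction monoid whose natural partial order is inclusion. For $A\in\mathsf{R}(S)$ let $\nu(A)=A^\vee$ be the set of all joins of finite compatible subsets of $A$ (including the empty join $0$). Put $\mathsf{R}(S)_\nu=\{A\in\mathsf{R}(S):\nu(A)=A\}$ with product $A\cdot B=\nu(AB)$ and star $A^\circ=\nu(A^* )$; this is a complete right restriction monoid whose natural partial order is inclusion and whose joins are $\bigsqcup_i A_i=\nu(\bigcup_i A_i)$. An element $a$ of a complete right restriction monoid is finite if whenever $a\le\bigvee_{i\in I}a_i$ there is a finite $F\subseteq I$ with $a\le\bigvee_{i\in F}a_i$. Finally $\mathsf{Etale}(S)$ is the set of finite elements of $\mathsf{R}(S)_\nu$, with the operations $\cdot$ and $\circ$ inherited from $\mathsf{R}(S)_\nu$. *)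

theory Defs
  imports "HOL-Algebra.Coset"
begin

section \<open>Boolean algebras in a carrier-based order\<close>

locale boolean_algebra_order = bounded_lattice L for L (structure) +
  assumes meet_join_distrib:
    "\<lbrakk>x \<in> carrier L; y \<in> carrier L; z \<in> carrier L\<rbrakk>
      \<Longrightarrow> x \<sqinter> (y \<squnion> z) = (x \<sqinter> y) \<squnion> (x \<sqinter> z)"
  and complement_exists:
    "x \<in> carrier L \<Longrightarrow> \<exists>y\<in>carrier L. x \<sqinter> y = \<bottom> \<and> x \<squnion> y = \<top>"


section \<open>Right restriction monoids\<close>

record 'a star_monoid = "'a monoid" +
  star :: "'a \<Rightarrow> 'a"

locale right_restriction_monoid = monoid M for M (structure) +
  assumes star_closed: "s \<in> carrier M \<Longrightarrow> star M s \<in> carrier M"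
  and RR1: "s \<in> carrier M \<Longrightarrow> star M (star M s) = star M s"
  and RR2: "\<lbrakk>s \<in> carrier M; t \<in> carrier M\<rbrakk>
    \<Longrightarrow> star M (star M s \<otimes> star M t) = star M s \<otimes> star M t"
  and RR3: "\<lbrakk>s \<in> carrier M; t \<in> carrier M\<rbrakk>
    \<Longrightarrow> star M s \<otimes> star M t = star M t \<otimes> star M s"
  and RR4: "s \<in> carrier M \<Longrightarrow> s \<otimes> star M s = s"
  and RR5: "\<lbrakk>s \<in> carrier M; t \<in> carrier M\<rbrakk>
    \<Longrightarrow> star M (s \<otimes> t) = star M (star M s \<otimes> t)"
  and RR6: "\<lbrakk>s \<in> carrier M; t \<in> carrier M\<rbrakk>
    \<Longrightarrow> star M t \<otimes> s = s \<otimes> star M (t \<otimes> s)"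

definition Proj :: "('a, 'm) star_monoid_scheme \<Rightarrow> 'a set"
  where "Proj M = {a \<in> carrier M. star M a = a}"

definition nat_le :: "('a, 'm) star_monoid_scheme \<Rightarrow> 'a \<Rightarrow> 'a \<Rightarrow> bool"
  where "nat_le M a b \<longleftrightarrow> a = b \<otimes>\<^bsub>M\<^esub> star M a"

text \<open>The natural partial order on a subset \<open>X\<close> of the carrier.\<close>

definition nat_order_on :: "('a, 'm) star_monoid_scheme \<Rightarrow> 'a set \<Rightarrow> 'a gorder"
  where "nat_order_on M X = \<lparr>carrier = X, eq = (=), le = nat_le M\<rparr>"

definition is_join :: "('a, 'm) star_monoid_scheme \<Rightarrow> 'a \<Rightarrow> 'a set \<Rightarrow> bool"
  where "is_join M j X \<longleftrightarrow>
    least (nat_order_on M (carrier M)) j (Upper (nat_order_on M (carrier M)) X)"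

definition left_compatible :: "('a, 'm) star_monoid_scheme \<Rightarrow> 'a \<Rightarrow> 'a \<Rightarrow> bool"
  where "left_compatible M a b \<longleftrightarrow> a \<otimes>\<^bsub>M\<^esub> star M b = b \<otimes>\<^bsub>M\<^esub> star M a"

definition left_compatible_set :: "('a, 'm) star_monoid_scheme \<Rightarrow> 'a set \<Rightarrow> bool"
  where "left_compatible_set M X \<longleftrightarrow> (\<forall>a\<in>X. \<forall>b\<in>X. left_compatible M a b)"

definition is_zero :: "('a, 'm) monoid_scheme \<Rightarrow> 'a \<Rightarrow> bool"
  where "is_zero M z \<longleftrightarrow>
    z \<in> carrier M \<and> (\<forall>x\<in>carrier M. z \<otimes>\<^bsub>M\<^esub> x = z \<and> x \<otimes>\<^bsub>M\<^esub> z = z)"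

locale boolean_right_restriction_monoid = right_restriction_monoid M for M (structure) +
  assumes binary_join_exists:
    "\<lbrakk>a \<in> carrier M; b \<in> carrier M; left_compatible M a b\<rbrakk> \<Longrightarrow> \<exists>j. is_join M j {a, b}"
  and binary_join_mult:
    "\<lbrakk>a \<in> carrier M; b \<in> carrier M; c \<in> carrier M; left_compatible M a b; is_join M j {a, b}\<rbrakk>
      \<Longrightarrow> is_join M (j \<otimes> c) {a \<otimes> c, b \<otimes> c}"
  and Proj_boolean: "boolean_algebra_order (nat_order_on M (Proj M))"
  and Proj_bottom_zero: "is_zero M (\<bottom>\<^bsub>nat_order_on M (Proj M)\<^esub>)"

definition partial_units :: "('a, 'm) star_monoid_scheme \<Rightarrow> 'a set"
  where "partial_units M =
    {a \<in> carrier M. \<exists>b\<in>carrier M. b \<otimes>\<^bsub>M\<^esub> a = star M a \<and> a \<otimes>\<^bsub>M\<^esub> b = star M b}"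

definition Inv :: "('a, 'm) star_monoid_scheme \<Rightarrow> 'a monoid"
  where "Inv M = \<lparr>carrier = partial_units M, mult = mult M, one = \<one>\<^bsub>M\<^esub>\<rparr>"

locale etale_boolean_right_restriction_monoid =
  boolean_right_restriction_monoid M for M (structure) +
  assumes join_of_partial_units:
    "a \<in> carrier M \<Longrightarrow> \<exists>F. finite F \<and> F \<subseteq> partial_units M \<and> is_join M a F"

text \<open>
  In a complete right restriction monoid exactly the left-compatible sets have joins, so only
  those need to be considered, and the join \<open>k\<close> of \<open>F\<close> below always exists and is unique.
  Quantifying over subsets is the same as quantifying over indexed families.
\<close>

definition finite_elements :: "('a, 'm) star_monoid_scheme \<Rightarrow> 'a set"
  where "finite_elements M =
    {a \<in> carrier M. \<forall>X j. X \<subseteq> carrier M \<and> left_compatible_set M X \<and> is_join M j X \<and> nat_le M a j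
      \<longrightarrow> (\<exists>F k. finite F \<and> F \<subseteq> X \<and> is_join M k F \<and> nat_le M a k)}"


section \<open>Boolean inverse monoids\<close>

locale inverse_monoid = monoid S for S (structure) +
  assumes unique_inverse:
    "a \<in> carrier S \<Longrightarrow> \<exists>!b. b \<in> carrier S \<and> a \<otimes> b \<otimes> a = a \<and> b \<otimes> a \<otimes> b = b"

text \<open>The library's \<open>m_inv\<close> is the inverse of a unit, hence not usable here.\<close>

definition sinv :: "('a, 'm) monoid_scheme \<Rightarrow> 'a \<Rightarrow> 'a"
  where "sinv S a = (THE b. b \<in> carrier S \<and> a \<otimes>\<^bsub>S\<^esub> b \<otimes>\<^bsub>S\<^esub> a = a \<and> b \<otimes>\<^bsub>S\<^esub> a \<otimes>\<^bsub>S\<^esub> b = b)"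

definition inv_star :: "('a, 'm) monoid_scheme \<Rightarrow> 'a star_monoid"
  where "inv_star S =
    \<lparr>carrier = carrier S, mult = mult S, one = \<one>\<^bsub>S\<^esub>, star = (\<lambda>a. sinv S a \<otimes>\<^bsub>S\<^esub> a)\<rparr>"

definition idempotents :: "('a, 'm) monoid_scheme \<Rightarrow> 'a set"
  where "idempotents S = {e \<in> carrier S. e \<otimes>\<^bsub>S\<^esub> e = e}"

definition compatible :: "('a, 'm) monoid_scheme \<Rightarrow> 'a \<Rightarrow> 'a \<Rightarrow> bool"
  where "compatible S a b \<longleftrightarrow>
    a \<otimes>\<^bsub>S\<^esub> sinv S b \<in> idempotents S \<and> sinv S a \<otimes>\<^bsub>S\<^esub> b \<in> idempotents S"

locale boolean_inverse_monoid = inverse_monoid S for S (structure) +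
  assumes zero_exists: "\<exists>z. is_zero S z"
  and compatible_join_exists:
    "\<lbrakk>a \<in> carrier S; b \<in> carrier S; compatible S a b\<rbrakk> \<Longrightarrow> \<exists>j. is_join (inv_star S) j {a, b}"
  and compatible_join_mult_left:
    "\<lbrakk>a \<in> carrier S; b \<in> carrier S; c \<in> carrier S; compatible S a b; is_join (inv_star S) j {a, b}\<rbrakk>
      \<Longrightarrow> is_join (inv_star S) (c \<otimes> j) {c \<otimes> a, c \<otimes> b}"
  and compatible_join_mult_right:
    "\<lbrakk>a \<in> carrier S; b \<in> carrier S; c \<in> carrier S; compatible S a b; is_join (inv_star S) j {a, b}\<rbrakk>
      \<Longrightarrow> is_join (inv_star S) (j \<otimes> c) {a \<otimes> c, b \<otimes> c}"
  and idempotents_boolean: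
    "boolean_algebra_order (nat_order_on (inv_star S) (idempotents S))"


section \<open>The companion of a Boolean inverse monoid\<close>

definition acceptable :: "('a, 'm) monoid_scheme \<Rightarrow> 'a set \<Rightarrow> bool"
  where "acceptable S A \<longleftrightarrow>
    A \<subseteq> carrier S \<and> left_compatible_set (inv_star S) A \<and>
    (\<forall>a\<in>A. \<forall>b\<in>carrier S. nat_le (inv_star S) b a \<longrightarrow> b \<in> A)"

text \<open>The identity of \<open>R(S)\<close>, and also of \<open>R(S)\<^sub>\<nu>\<close>, is the set of idempotents of \<open>S\<close>,
  which is the order ideal generated by \<open>1\<close>.\<close>

definition R_monoid :: "('a, 'm) monoid_scheme \<Rightarrow> 'a set star_monoid"
  where "R_monoid S =
    \<lparr>carrier = {A. acceptable S A}, mult = (\<lambda>A B. A <#>\<^bsub>S\<^esub> B), one = idempotents S,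
     star = (\<lambda>A. star (inv_star S) ` A)\<rparr>"

definition nu :: "('a, 'm) monoid_scheme \<Rightarrow> 'a set \<Rightarrow> 'a set"
  where "nu S A = {j. \<exists>F. finite F \<and> F \<subseteq> A \<and> (\<forall>a\<in>F. \<forall>b\<in>F. compatible S a b) \<and>
    is_join (inv_star S) j F}"

definition R_nu :: "('a, 'm) monoid_scheme \<Rightarrow> 'a set star_monoid"
  where "R_nu S =
    \<lparr>carrier = {A \<in> carrier (R_monoid S). nu S A = A},
     mult = (\<lambda>A B. nu S (A \<otimes>\<^bsub>R_monoid S\<^esub> B)),
     one = \<one>\<^bsub>R_monoid S\<^esub>,
     star = (\<lambda>A. nu S (star (R_monoid S) A))\<rparr>"

definition Etale :: "('a, 'm) monoid_scheme \<Rightarrow> 'a set star_monoid"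
  where "Etale S = (R_nu S)\<lparr>carrier := finite_elements (R_nu S)\<rparr>"

end

theory Submission
  imports Defs
begin

text \<open>
  Think of the elements of \<open>S\<close> as partial bijections, with \<open>a\<^sup>\<star> = a\<^sup>\<dagger> a\<close> the domain of \<open>a\<close>. Left
  compatibility of \<open>a\<close> and \<open>b\<close>, equivalently idempotency of \<open>a b\<^sup>\<dagger>\<close>, says that \<open>a\<close> and \<open>b\<close> agree on
  their common domain; compatibility says the same of the inverses as well. An acceptable set is
  then a partial function glued together from partial bijections, and the closure \<open>\<nu>\<close> identifies
  sets that describe the same function by adding the finite joins that exist already in \<open>S\<close>.

  The closure causes no trouble: because products distribute over finite compatible joins,
  \<open>\<nu>(\<nu>(A) \<nu>(B)) = \<nu>(A B)\<close> and \<open>\<nu>(\<nu>(A)\<^sup>\<star>) = \<nu>(A\<^sup>\<star>)\<close> (\<open>nu_mult\<close>, \<open>nu_domains\<close>), so each right restriction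
  axiom has to be checked for plain sets of products only, where it follows from its counterpart in
  \<open>S\<close> and left compatibility. On closed sets the natural order is inclusion, and a left-compatible
  family \<open>X\<close> has the join \<open>\<nu>(\<Union>X)\<close> (\<open>nat_le_R_nu_on_iff\<close>, \<open>nu_Union_is_join\<close>).

  The finite elements are therefore exactly the sets \<open>\<nu>(\<down>F)\<close> generated by a finite left-compatible set
  \<open>F\<close> (\<open>finite_elements_iff\<close>): a closed set is the join of the principal ideals \<open>\<down>a\<close> of its members, and
  membership in a join involves finitely many members of the family only. These sets are closed
  under products, stars and unions of left-compatible pairs, and \<open>\<nu>(\<down>F)\<close> is the join of the
  finitely many \<open>\<down>f\<close> with \<open>f \<in> F\<close>.

  The map \<open>a \<mapsto> \<down>a\<close> is an injective homomorphism and an order embedding. A finitely generated set whose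
  members are pairwise compatible is principal, because the join of its generators exists in \<open>S\<close>
  (\<open>compatible_generated_principal\<close>). Applied to sets of idempotents this identifies the projections
  with the Boolean algebra of idempotents of \<open>S\<close>. The remaining point is that a partial unit is
  pairwise compatible (\<open>partial_unit_compatible\<close>): an inverse of it contains \<open>a\<^sup>\<dagger>\<close> for each of its
  members \<open>a\<close>. So the partial units are exactly the principal ideals, which form a copy of \<open>S\<close> and
  whose finite joins exhaust \<open>Etale(S)\<close>.
\<close>

section \<open>Inverse monoids\<close>

context inverse_monoid
begin

abbreviation inverse_of (\<open>_\<^sup>\<dagger>\<close> [1000] 999)
  where "a\<^sup>\<dagger> \<equiv> sinv S a"

abbreviation domain_of (\<open>_\<^sup>\<star>\<close> [1000] 999)
  where "a\<^sup>\<star> \<equiv> a\<^sup>\<dagger> \<otimes> a"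

abbreviation below (infix \<open>\<preceq>\<close> 50)
  where "a \<preceq> b \<equiv> nat_le (inv_star S) a b"

abbreviation idems (\<open>E\<close>)
  where "E \<equiv> idempotents S"

lemma inv_star_simps [simp]:
  "carrier (inv_star S) = carrier S" "mult (inv_star S) = mult S"
  "one (inv_star S) = \<one>" "star (inv_star S) a = a\<^sup>\<star>"
  by (simp_all add: inv_star_def)

lemma below_def: "a \<preceq> b \<longleftrightarrow> a = b \<otimes> a\<^sup>\<star>"
  by (simp add: nat_le_def)

lemma inverse_props:
  assumes "a \<in> carrier S"
  shows "a\<^sup>\<dagger> \<in> carrier S" "a \<otimes> a\<^sup>\<dagger> \<otimes> a = a" "a\<^sup>\<dagger> \<otimes> a \<otimes> a\<^sup>\<dagger> = a\<^sup>\<dagger>"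
  using theI'[OF unique_inverse[OF assms]] unfolding sinv_def by auto

lemmas inverse_closed [simp] = inverse_props(1)

lemma domain_closed [simp]: "a \<in> carrier S \<Longrightarrow> a\<^sup>\<star> \<in> carrier S"
  by simp

lemma inverse_cancel [simp]:
  assumes "a \<in> carrier S"
  shows "a \<otimes> (a\<^sup>\<dagger> \<otimes> a) = a" "a\<^sup>\<dagger> \<otimes> (a \<otimes> a\<^sup>\<dagger>) = a\<^sup>\<dagger>"
  using inverse_props[OF assms] assms by (simp_all add: m_assoc)

lemma inverse_cancel_assoc [simp]:
  assumes "a \<in> carrier S" "c \<in> carrier S"
  shows "a \<otimes> (a\<^sup>\<dagger> \<otimes> (a \<otimes> c)) = a \<otimes> c" "a\<^sup>\<dagger> \<otimes> (a \<otimes> (a\<^sup>\<dagger> \<otimes> c)) = a\<^sup>\<dagger> \<otimes> c"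
  using inverse_cancel[OF assms(1)] assms by (metis inverse_closed m_assoc m_closed)+

lemma inverse_eqI:
  assumes "a \<in> carrier S" "b \<in> carrier S" "a \<otimes> b \<otimes> a = a" "b \<otimes> a \<otimes> b = b"
  shows "a\<^sup>\<dagger> = b"
  using unique_inverse[OF assms(1)] inverse_props[OF assms(1)] assms by blast

lemma inverse_inverse [simp]: "a \<in> carrier S \<Longrightarrow> (a\<^sup>\<dagger>)\<^sup>\<dagger> = a"
  by (rule inverse_eqI) (auto simp: inverse_props)

lemma idem_carrier [simp]: "e \<in> E \<Longrightarrow> e \<in> carrier S"
  and idem_idem [simp]: "e \<in> E \<Longrightarrow> e \<otimes> e = e"
  by (auto simp: idempotents_def)

lemma idem_idem_assoc [simp]: "\<lbrakk>e \<in> E; c \<in> carrier S\<rbrakk> \<Longrightarrow> e \<otimes> (e \<otimes> c) = e \<otimes> c"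
  by (simp add: m_assoc[symmetric])

lemma idemI: "\<lbrakk>e \<in> carrier S; e \<otimes> e = e\<rbrakk> \<Longrightarrow> e \<in> E"
  unfolding idempotents_def by blast

lemma idem_inverse [simp]: "e \<in> E \<Longrightarrow> e\<^sup>\<dagger> = e"
  by (rule inverse_eqI) simp_all

text \<open>The inverse \<open>x\<close> of a product \<open>e \<otimes> f\<close> of idempotents equals \<open>f \<otimes> x \<otimes> e\<close>, by uniqueness of
  inverses; hence \<open>x\<close> is idempotent and so is its own inverse \<open>e \<otimes> f\<close>.\<close>

lemma idem_mult [simp]:
  assumes e: "e \<in> E" and f: "f \<in> E"
  shows "e \<otimes> f \<in> E"
proof -
  define x where "x = (e \<otimes> f)\<^sup>\<dagger>"
  have ef: "e \<otimes> f \<in> carrier S" and x: "x \<in> carrier S"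
    using e f by (auto simp: x_def)
  have c1: "e \<otimes> (f \<otimes> (x \<otimes> (e \<otimes> f))) = e \<otimes> f"
    using inverse_props(2)[OF ef] e f x unfolding x_def[symmetric] by (simp add: m_assoc)
  have c2: "x \<otimes> (e \<otimes> (f \<otimes> x)) = x"
    using inverse_props(3)[OF ef] e f x unfolding x_def[symmetric] by (simp add: m_assoc)
  have c3: "x \<otimes> (e \<otimes> (f \<otimes> (x \<otimes> e))) = x \<otimes> e"
  proof -
    have "x \<otimes> (e \<otimes> (f \<otimes> (x \<otimes> e))) = (x \<otimes> (e \<otimes> (f \<otimes> x))) \<otimes> e"
      using e f x by (simp add: m_assoc)
    then show ?thesis by (simp only: c2)
  qed
  have "(e \<otimes> f)\<^sup>\<dagger> = f \<otimes> (x \<otimes> e)"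
    using ef e f x by (intro inverse_eqI) (simp_all add: m_assoc c1 c3)
  then have fxe: "f \<otimes> (x \<otimes> e) = x" unfolding x_def[symmetric] by (rule sym)
  have "x \<otimes> x = (f \<otimes> (x \<otimes> e)) \<otimes> (f \<otimes> (x \<otimes> e))" by (simp only: fxe)
  also have "\<dots> = f \<otimes> (x \<otimes> (e \<otimes> (f \<otimes> (x \<otimes> e))))" using e f x by (simp add: m_assoc)
  also have "\<dots> = x" by (simp only: c3) (simp only: fxe)
  finally have "x \<in> E" using x by (simp add: idemI)
  moreover have "x = e \<otimes> f"
    using idem_inverse[OF \<open>x \<in> E\<close>] inverse_inverse[OF ef] unfolding x_def by argo
  ultimately show ?thesis by simp
qed

lemma idem_commute:
  assumes e: "e \<in> E" and f: "f \<in> E"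
  shows "e \<otimes> f = f \<otimes> e"
proof -
  have ef: "e \<otimes> f \<in> E" and fe: "f \<otimes> e \<in> E" using e f by auto
  have "e \<otimes> f \<otimes> (f \<otimes> e) \<otimes> (e \<otimes> f) = (e \<otimes> f) \<otimes> (e \<otimes> f)"
    "f \<otimes> e \<otimes> (e \<otimes> f) \<otimes> (f \<otimes> e) = (f \<otimes> e) \<otimes> (f \<otimes> e)"
    using e f by (simp_all add: m_assoc del: idem_idem)
  then have "(e \<otimes> f)\<^sup>\<dagger> = f \<otimes> e"
    using ef fe by (intro inverse_eqI) (simp_all only: idem_idem idem_carrier)
  then show ?thesis using idem_inverse[OF ef] by simp
qed

lemma domain_idem [simp]: "a \<in> carrier S \<Longrightarrow> a\<^sup>\<star> \<in> E"
  by (rule idemI) (auto simp: m_assoc)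

lemma range_idem [simp]: "a \<in> carrier S \<Longrightarrow> a \<otimes> a\<^sup>\<dagger> \<in> E"
  by (rule idemI) (auto simp: m_assoc)

lemma inverse_mult:
  assumes a: "a \<in> carrier S" and b: "b \<in> carrier S"
  shows "(a \<otimes> b)\<^sup>\<dagger> = b\<^sup>\<dagger> \<otimes> a\<^sup>\<dagger>"
proof (rule inverse_eqI)
  have com: "b \<otimes> b\<^sup>\<dagger> \<otimes> (a\<^sup>\<dagger> \<otimes> a) = a\<^sup>\<dagger> \<otimes> a \<otimes> (b \<otimes> b\<^sup>\<dagger>)"
    using a b by (intro idem_commute) auto
  have "a \<otimes> b \<otimes> (b\<^sup>\<dagger> \<otimes> a\<^sup>\<dagger>) \<otimes> (a \<otimes> b) = a \<otimes> (b \<otimes> b\<^sup>\<dagger> \<otimes> (a\<^sup>\<dagger> \<otimes> a)) \<otimes> b"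
    using a b by (simp add: m_assoc)
  also have "\<dots> = a \<otimes> b" unfolding com using a b by (simp add: m_assoc)
  finally show "a \<otimes> b \<otimes> (b\<^sup>\<dagger> \<otimes> a\<^sup>\<dagger>) \<otimes> (a \<otimes> b) = a \<otimes> b" .
  have "b\<^sup>\<dagger> \<otimes> a\<^sup>\<dagger> \<otimes> (a \<otimes> b) \<otimes> (b\<^sup>\<dagger> \<otimes> a\<^sup>\<dagger>) = b\<^sup>\<dagger> \<otimes> (a\<^sup>\<dagger> \<otimes> a \<otimes> (b \<otimes> b\<^sup>\<dagger>)) \<otimes> a\<^sup>\<dagger>"
    using a b by (simp add: m_assoc)
  also have "\<dots> = b\<^sup>\<dagger> \<otimes> a\<^sup>\<dagger>" unfolding com[symmetric] using a b by (simp add: m_assoc)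
  finally show "b\<^sup>\<dagger> \<otimes> a\<^sup>\<dagger> \<otimes> (a \<otimes> b) \<otimes> (b\<^sup>\<dagger> \<otimes> a\<^sup>\<dagger>) = b\<^sup>\<dagger> \<otimes> a\<^sup>\<dagger>" .
qed (use a b in auto)

lemma one_idem [simp]: "\<one> \<in> E"
  by (rule idemI) auto

lemma conjugate_idem:
  assumes a: "a \<in> carrier S" and e: "e \<in> E"
  shows "a \<otimes> e \<otimes> a\<^sup>\<dagger> \<in> E" "a\<^sup>\<dagger> \<otimes> e \<otimes> a \<in> E"
proof -
  have *: "b \<otimes> e \<otimes> b\<^sup>\<dagger> \<in> E" if b: "b \<in> carrier S" for b
  proof (rule idemI)
    have "b \<otimes> e \<otimes> b\<^sup>\<dagger> \<otimes> (b \<otimes> e \<otimes> b\<^sup>\<dagger>) = b \<otimes> (e \<otimes> (b\<^sup>\<dagger> \<otimes> b)) \<otimes> (e \<otimes> b\<^sup>\<dagger>)"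
      using b e by (simp add: m_assoc)
    also have "e \<otimes> (b\<^sup>\<dagger> \<otimes> b) = b\<^sup>\<dagger> \<otimes> b \<otimes> e"
      using b e by (intro idem_commute) auto
    finally show "b \<otimes> e \<otimes> b\<^sup>\<dagger> \<otimes> (b \<otimes> e \<otimes> b\<^sup>\<dagger>) = b \<otimes> e \<otimes> b\<^sup>\<dagger>"
      using b e by (simp add: m_assoc)
  qed (use b e in auto)
  from *[OF a] *[OF inverse_closed[OF a]] a
  show "a \<otimes> e \<otimes> a\<^sup>\<dagger> \<in> E" "a\<^sup>\<dagger> \<otimes> e \<otimes> a \<in> E" by auto
qed

text \<open>Conjugation by \<open>a\<close> turns an idempotent on one side of \<open>a\<close> into one on the other side. Hence
  restricting \<open>a\<close> on the left or on the right describes one and the same order.\<close>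

lemma idem_past:
  assumes a: "a \<in> carrier S" and e: "e \<in> E"
  shows "e \<otimes> a = a \<otimes> (a\<^sup>\<dagger> \<otimes> e \<otimes> a)" "a \<otimes> e = (a \<otimes> e \<otimes> a\<^sup>\<dagger>) \<otimes> a"
proof -
  have "a \<otimes> (a\<^sup>\<dagger> \<otimes> e \<otimes> a) = (a \<otimes> a\<^sup>\<dagger> \<otimes> e) \<otimes> a"
    using a e by (simp add: m_assoc)
  also have "a \<otimes> a\<^sup>\<dagger> \<otimes> e = e \<otimes> (a \<otimes> a\<^sup>\<dagger>)"
    using a e by (intro idem_commute) auto
  finally show "e \<otimes> a = a \<otimes> (a\<^sup>\<dagger> \<otimes> e \<otimes> a)" using a e by (simp add: m_assoc)
  have "a \<otimes> e \<otimes> a\<^sup>\<dagger> \<otimes> a = a \<otimes> (e \<otimes> (a\<^sup>\<dagger> \<otimes> a))"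
    using a e by (simp add: m_assoc)
  also have "e \<otimes> (a\<^sup>\<dagger> \<otimes> a) = a\<^sup>\<dagger> \<otimes> a \<otimes> e"
    using a e by (intro idem_commute) auto
  finally show "a \<otimes> e = (a \<otimes> e \<otimes> a\<^sup>\<dagger>) \<otimes> a" using a e by (simp add: m_assoc)
qed

lemma below_right_iff:
  assumes a: "a \<in> carrier S" and b: "b \<in> carrier S"
  shows "a \<preceq> b \<longleftrightarrow> (\<exists>e\<in>E. a = b \<otimes> e)"
proof
  assume "a \<preceq> b"
  then show "\<exists>e\<in>E. a = b \<otimes> e" using a below_def domain_idem by blast
next
  assume "\<exists>e\<in>E. a = b \<otimes> e"
  then obtain e where e: "e \<in> E" and ae: "a = b \<otimes> e" by blast
  have "a\<^sup>\<star> = e \<otimes> (b\<^sup>\<star> \<otimes> e)"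
    using b e by (simp add: ae inverse_mult m_assoc)
  also have "b\<^sup>\<star> \<otimes> e = e \<otimes> b\<^sup>\<star>" using b e by (intro idem_commute) auto
  also have "e \<otimes> (e \<otimes> b\<^sup>\<star>) = e \<otimes> b\<^sup>\<star>" using b e by simp
  also have "e \<otimes> b\<^sup>\<star> = b\<^sup>\<star> \<otimes> e" using b e by (intro idem_commute) auto
  finally show "a \<preceq> b" using b e by (simp add: below_def ae m_assoc)
qed

lemma below_left_iff:
  assumes a: "a \<in> carrier S" and b: "b \<in> carrier S"
  shows "a \<preceq> b \<longleftrightarrow> (\<exists>e\<in>E. a = e \<otimes> b)"
  unfolding below_right_iff[OF assms] using idem_past[OF b] conjugate_idem[OF b] by metis

lemma below_refl [simp]: "a \<in> carrier S \<Longrightarrow> a \<preceq> a"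
  by (simp add: below_def)

lemma below_trans:
  assumes "a \<preceq> b" "b \<preceq> c" "a \<in> carrier S" "b \<in> carrier S" "c \<in> carrier S"
  shows "a \<preceq> c"
proof -
  obtain e f where "e \<in> E" "f \<in> E" "a = b \<otimes> e" "b = c \<otimes> f"
    using assms by (meson below_right_iff)
  then have "a = c \<otimes> (f \<otimes> e)" "f \<otimes> e \<in> E" using assms by (auto simp: m_assoc)
  then show ?thesis using assms by (auto simp: below_right_iff)
qed

lemma below_antisym:
  assumes ab: "a \<preceq> b" and ba: "b \<preceq> a" and a: "a \<in> carrier S" and b: "b \<in> carrier S"
  shows "a = b"
proof -
  have 1: "a = b \<otimes> a\<^sup>\<star>" and 2: "b = a \<otimes> b\<^sup>\<star>" using ab ba by (auto simp: below_def)
  have "b = b \<otimes> a\<^sup>\<star> \<otimes> b\<^sup>\<star>" using 1 2 by simp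
  also have "\<dots> = b \<otimes> (a\<^sup>\<star> \<otimes> b\<^sup>\<star>)" using a b by (simp add: m_assoc)
  also have "a\<^sup>\<star> \<otimes> b\<^sup>\<star> = b\<^sup>\<star> \<otimes> a\<^sup>\<star>" using a b by (intro idem_commute) auto
  also have "b \<otimes> (b\<^sup>\<star> \<otimes> a\<^sup>\<star>) = b \<otimes> a\<^sup>\<star>" using a b by (simp add: m_assoc)
  finally show ?thesis using 1 by simp
qed

lemma below_mult_idem:
  assumes "a \<in> carrier S" "e \<in> E"
  shows "a \<otimes> e \<preceq> a" "e \<otimes> a \<preceq> a"
  using assms below_right_iff[of "a \<otimes> e" a] below_left_iff[of "e \<otimes> a" a] by auto

lemma below_mult:
  assumes "a \<preceq> b" "c \<preceq> d" "a \<in> carrier S" "b \<in> carrier S" "c \<in> carrier S" "d \<in> carrier S"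
  shows "a \<otimes> c \<preceq> b \<otimes> d"
proof -
  obtain e f where e: "e \<in> E" and f: "f \<in> E" and a: "a = e \<otimes> b" and c: "c = d \<otimes> f"
    using assms by (meson below_right_iff below_left_iff)
  have "a \<otimes> c = e \<otimes> (b \<otimes> d \<otimes> f)"
    using e f assms by (simp add: a c m_assoc)
  moreover have "e \<otimes> (b \<otimes> d \<otimes> f) \<preceq> b \<otimes> d \<otimes> f" "b \<otimes> d \<otimes> f \<preceq> b \<otimes> d"
    using e f assms by (auto intro: below_mult_idem)
  ultimately show ?thesis
    using below_trans[of "a \<otimes> c" "b \<otimes> d \<otimes> f" "b \<otimes> d"] e f assms by auto
qed

lemma below_inverse:
  assumes "a \<preceq> b" "a \<in> carrier S" "b \<in> carrier S"
  shows "a\<^sup>\<dagger> \<preceq> b\<^sup>\<dagger>"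
proof -
  obtain e where "e \<in> E" "a = b \<otimes> e" using assms by (meson below_right_iff)
  then have "a\<^sup>\<dagger> = e \<otimes> b\<^sup>\<dagger>" using assms by (simp add: inverse_mult)
  then show ?thesis using \<open>e \<in> E\<close> assms by (auto simp: below_left_iff)
qed

lemma below_idem:
  assumes "a \<preceq> e" "e \<in> E" "a \<in> carrier S"
  shows "a \<in> E"
  using assms by (metis below_right_iff idem_carrier idem_mult)

lemma below_one_iff: "a \<in> carrier S \<Longrightarrow> a \<preceq> \<one> \<longleftrightarrow> a \<in> E"
  using below_idem[of a \<one>] below_mult_idem[of \<one> a] by auto

lemma below_domain_mult:
  assumes "a \<preceq> b" "a \<in> carrier S" "b \<in> carrier S"
  shows "b \<otimes> a\<^sup>\<star> = a"
  using assms by (metis below_def)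

text \<open>For partial bijections, idempotency of \<open>a \<otimes> b\<^sup>\<dagger>\<close> says that \<open>a\<close> and \<open>b\<close> agree wherever both are
  defined. Unlike the defining equation of left compatibility, this form visibly passes to smaller
  elements, and it passes to joins because a join of idempotents is idempotent.\<close>

lemma left_compatible_iff:
  assumes a: "a \<in> carrier S" and b: "b \<in> carrier S"
  shows "left_compatible (inv_star S) a b \<longleftrightarrow> a \<otimes> b\<^sup>\<dagger> \<in> E"
proof
  assume "left_compatible (inv_star S) a b"
  then have eq: "a \<otimes> b\<^sup>\<star> = b \<otimes> a\<^sup>\<star>" by (simp add: left_compatible_def)
  have "a \<otimes> b\<^sup>\<dagger> = (a \<otimes> b\<^sup>\<star>) \<otimes> b\<^sup>\<dagger>" using a b by (simp add: m_assoc)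
  also have "\<dots> = b \<otimes> a\<^sup>\<star> \<otimes> b\<^sup>\<dagger>" by (simp only: eq)
  also have "\<dots> \<in> E" using a b by (intro conjugate_idem) auto
  finally show "a \<otimes> b\<^sup>\<dagger> \<in> E" .
next
  assume E: "a \<otimes> b\<^sup>\<dagger> \<in> E"
  then have "(a \<otimes> b\<^sup>\<dagger>)\<^sup>\<dagger> = a \<otimes> b\<^sup>\<dagger>" by simp
  then have sym: "b \<otimes> a\<^sup>\<dagger> = a \<otimes> b\<^sup>\<dagger>" using a b by (simp add: inverse_mult)
  have "a \<otimes> b\<^sup>\<star> = a \<otimes> (a\<^sup>\<star> \<otimes> b\<^sup>\<star>)" using a b by (simp add: m_assoc)
  also have "a\<^sup>\<star> \<otimes> b\<^sup>\<star> = b\<^sup>\<star> \<otimes> a\<^sup>\<star>" using a b by (intro idem_commute) auto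
  also have "a \<otimes> (b\<^sup>\<star> \<otimes> a\<^sup>\<star>) = (a \<otimes> b\<^sup>\<dagger>) \<otimes> (b \<otimes> a\<^sup>\<dagger> \<otimes> a)" using a b by (simp add: m_assoc)
  also have "\<dots> = (b \<otimes> a\<^sup>\<dagger>) \<otimes> ((b \<otimes> a\<^sup>\<dagger>) \<otimes> a)" by (simp only: sym)
  also have "\<dots> = (b \<otimes> a\<^sup>\<dagger>) \<otimes> a" using E a by (simp only: sym idem_idem_assoc)
  also have "\<dots> = b \<otimes> a\<^sup>\<star>" using a b by (simp add: m_assoc)
  finally show "left_compatible (inv_star S) a b" by (simp add: left_compatible_def)
qed

lemma left_compatible_sym:
  assumes "a \<otimes> b\<^sup>\<dagger> \<in> E" "a \<in> carrier S" "b \<in> carrier S"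
  shows "b \<otimes> a\<^sup>\<dagger> \<in> E"
proof -
  have "b \<otimes> a\<^sup>\<dagger> = (a \<otimes> b\<^sup>\<dagger>)\<^sup>\<dagger>" using assms(2,3) by (simp add: inverse_mult)
  then show ?thesis using assms(1) by (simp only: idem_inverse)
qed

lemma compatible_iff: "compatible S a b \<longleftrightarrow> a \<otimes> b\<^sup>\<dagger> \<in> E \<and> a\<^sup>\<dagger> \<otimes> b \<in> E"
  by (simp add: compatible_def)

lemma left_compatible_below:
  assumes "a \<otimes> b\<^sup>\<dagger> \<in> E" "x \<preceq> a" "y \<preceq> b"
    and "a \<in> carrier S" "b \<in> carrier S" "x \<in> carrier S" "y \<in> carrier S"
  shows "x \<otimes> y\<^sup>\<dagger> \<in> E"
  using assms below_idem[of "x \<otimes> y\<^sup>\<dagger>" "a \<otimes> b\<^sup>\<dagger>"] below_mult[of x a "y\<^sup>\<dagger>" "b\<^sup>\<dagger>"] below_inverse[of y b]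
  by auto

lemma compatible_below:
  assumes "compatible S a b" "x \<preceq> a" "y \<preceq> b"
    and "a \<in> carrier S" "b \<in> carrier S" "x \<in> carrier S" "y \<in> carrier S"
  shows "compatible S x y"
  using assms left_compatible_below[of a b x y]
    left_compatible_below[of "a\<^sup>\<dagger>" "b\<^sup>\<dagger>" "x\<^sup>\<dagger>" "y\<^sup>\<dagger>"] below_inverse[of x a] below_inverse[of y b]
  by (simp add: compatible_iff)

lemma compatible_refl: "a \<in> carrier S \<Longrightarrow> compatible S a a"
  by (simp add: compatible_iff)

lemma compatible_idem: "\<lbrakk>e \<in> E; f \<in> E\<rbrakk> \<Longrightarrow> compatible S e f"
  by (simp add: compatible_iff)

lemma compatible_mult:
  assumes "compatible S a b" "a \<in> carrier S" "b \<in> carrier S" "c \<in> carrier S"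
  shows "compatible S (a \<otimes> c) (b \<otimes> c)" "compatible S (c \<otimes> a) (c \<otimes> b)"
proof -
  have l: "a \<otimes> b\<^sup>\<dagger> \<in> E" and r: "a\<^sup>\<dagger> \<otimes> b \<in> E" using assms by (auto simp: compatible_iff)
  have 1: "x \<otimes> z \<otimes> (y \<otimes> z)\<^sup>\<dagger> \<in> E" "(x \<otimes> z)\<^sup>\<dagger> \<otimes> (y \<otimes> z) \<in> E"
    if "x \<otimes> y\<^sup>\<dagger> \<in> E" "x\<^sup>\<dagger> \<otimes> y \<in> E" "x \<in> carrier S" "y \<in> carrier S" "z \<in> carrier S" for x y z
  proof -
    have "x \<otimes> (z \<otimes> z\<^sup>\<dagger>) \<preceq> x" using that(3,5) by (intro below_mult_idem) auto
    then have "x \<otimes> (z \<otimes> z\<^sup>\<dagger>) \<otimes> y\<^sup>\<dagger> \<in> E"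
      using that(3-5) by (intro left_compatible_below[OF that(1)]) auto
    also have "x \<otimes> (z \<otimes> z\<^sup>\<dagger>) \<otimes> y\<^sup>\<dagger> = x \<otimes> z \<otimes> (y \<otimes> z)\<^sup>\<dagger>"
      using that(3-5) by (simp add: inverse_mult m_assoc)
    finally show "x \<otimes> z \<otimes> (y \<otimes> z)\<^sup>\<dagger> \<in> E" .
    have "z\<^sup>\<dagger> \<otimes> (x\<^sup>\<dagger> \<otimes> y) \<otimes> z \<in> E" using conjugate_idem(2)[OF that(5,2)] .
    also have "z\<^sup>\<dagger> \<otimes> (x\<^sup>\<dagger> \<otimes> y) \<otimes> z = (x \<otimes> z)\<^sup>\<dagger> \<otimes> (y \<otimes> z)"
      using that(3-5) by (simp add: inverse_mult m_assoc)
    finally show "(x \<otimes> z)\<^sup>\<dagger> \<otimes> (y \<otimes> z) \<in> E" .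
  qed
  show "compatible S (a \<otimes> c) (b \<otimes> c)"
    unfolding compatible_iff using 1[OF l r assms(2-4)] by blast
  have "a\<^sup>\<dagger> \<otimes> (b\<^sup>\<dagger>)\<^sup>\<dagger> \<in> E" "(a\<^sup>\<dagger>)\<^sup>\<dagger> \<otimes> b\<^sup>\<dagger> \<in> E"
    using l r assms(2,3) by simp_all
  from 1[OF this, of "c\<^sup>\<dagger>"] show "compatible S (c \<otimes> a) (c \<otimes> b)"
    using assms(2-4) by (simp add: compatible_iff inverse_mult)
qed

end

section \<open>Finite joins of compatible elements\<close>

lemma is_join_iff:
  "is_join M j X \<longleftrightarrow> j \<in> carrier M \<and> (\<forall>x\<in>X \<inter> carrier M. nat_le M x j) \<and>
    (\<forall>y\<in>carrier M. (\<forall>x\<in>X \<inter> carrier M. nat_le M x y) \<longrightarrow> nat_le M j y)"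
  by (auto simp: is_join_def least_def Upper_def nat_order_on_def)

context inverse_monoid
begin

abbreviation is_sup
  where "is_sup j X \<equiv> is_join (inv_star S) j X"

abbreviation pairwise_compatible
  where "pairwise_compatible F \<equiv> \<forall>a\<in>F. \<forall>b\<in>F. compatible S a b"

lemma is_sup_carrier: "is_sup j X \<Longrightarrow> j \<in> carrier S"
  and is_sup_upper: "\<lbrakk>is_sup j X; x \<in> X; x \<in> carrier S\<rbrakk> \<Longrightarrow> x \<preceq> j"
  and is_sup_least: "\<lbrakk>is_sup j X; y \<in> carrier S; \<And>x. \<lbrakk>x \<in> X; x \<in> carrier S\<rbrakk> \<Longrightarrow> x \<preceq> y\<rbrakk> \<Longrightarrow> j \<preceq> y"
  by (auto simp: is_join_iff)

lemma is_supI: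
  "\<lbrakk>j \<in> carrier S; \<And>x. \<lbrakk>x \<in> X; x \<in> carrier S\<rbrakk> \<Longrightarrow> x \<preceq> j;
    \<And>y. \<lbrakk>y \<in> carrier S; \<And>x. \<lbrakk>x \<in> X; x \<in> carrier S\<rbrakk> \<Longrightarrow> x \<preceq> y\<rbrakk> \<Longrightarrow> j \<preceq> y\<rbrakk> \<Longrightarrow> is_sup j X"
  by (auto simp: is_join_iff)

lemma is_sup_unique: "\<lbrakk>is_sup j X; is_sup k X\<rbrakk> \<Longrightarrow> j = k"
  by (meson below_antisym is_sup_carrier is_sup_least is_sup_upper)

lemma is_sup_singleton: "a \<in> carrier S \<Longrightarrow> is_sup a {a}"
  by (auto intro: is_supI)

lemma is_sup_insert:
  assumes "is_sup j F" "is_sup k {j, x}" "x \<in> carrier S"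
  shows "is_sup k (insert x F)"
proof (rule is_supI)
  show k: "k \<in> carrier S" using assms(2) by (rule is_sup_carrier)
  have j: "j \<in> carrier S" using assms(1) by (rule is_sup_carrier)
  fix y assume "y \<in> insert x F" "y \<in> carrier S"
  then show "y \<preceq> k"
    using assms j k is_sup_upper[OF assms(1)] is_sup_upper[OF assms(2)] below_trans by (metis insert_iff)
next
  have j: "j \<in> carrier S" using assms(1) by (rule is_sup_carrier)
  fix y assume y: "y \<in> carrier S" "\<And>z. \<lbrakk>z \<in> insert x F; z \<in> carrier S\<rbrakk> \<Longrightarrow> z \<preceq> y"
  then have "j \<preceq> y" "x \<preceq> y" using is_sup_least[OF assms(1)] assms(3) by auto
  then show "k \<preceq> y" using is_sup_least[OF assms(2)] y by auto
qed

lemma is_sup_idem: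
  assumes "is_sup j F" "F \<subseteq> E"
  shows "j \<in> E"
proof -
  have "j \<preceq> \<one>" using assms by (intro is_sup_least[OF assms(1)]) (auto simp: below_one_iff)
  then show ?thesis using is_sup_carrier[OF assms(1)] by (simp add: below_one_iff)
qed

end

context boolean_inverse_monoid
begin

definition zero
  where "zero = (SOME z. is_zero S z)"

lemma zero:
  "zero \<in> carrier S" "x \<in> carrier S \<Longrightarrow> zero \<otimes> x = zero" "x \<in> carrier S \<Longrightarrow> x \<otimes> zero = zero"
proof -
  have "is_zero S zero" unfolding zero_def by (rule someI_ex[OF zero_exists])
  then show "zero \<in> carrier S" "x \<in> carrier S \<Longrightarrow> zero \<otimes> x = zero" "x \<in> carrier S \<Longrightarrow> x \<otimes> zero = zero"
    unfolding is_zero_def by blast+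
qed

lemma zero_below: "x \<in> carrier S \<Longrightarrow> zero \<preceq> x"
  by (simp add: below_def zero)

lemma zero_idem: "zero \<in> E"
  by (rule idemI) (simp_all add: zero)

lemma is_sup_empty: "is_sup zero {}"
  by (auto intro!: is_supI zero zero_below)

text \<open>The binary axioms extend to all finite compatible sets. For the induction to go through, an
  element \<open>x\<close> that is compatible with every \<open>f \<in> F\<close> has to be compatible with the join \<open>j\<close> of \<open>F\<close>;
  this holds because \<open>j \<otimes> x\<^sup>\<dagger>\<close> and \<open>j\<^sup>\<dagger> \<otimes> x\<close> are, by distributivity for \<open>F\<close>, up to inversion joins
  of idempotents, and such joins lie below \<open>\<one>\<close>.\<close>

lemma finite_join:
  assumes "finite F" "F \<subseteq> carrier S" "pairwise_compatible F"
  shows "\<exists>j. is_sup j F \<and> (\<forall>c\<in>carrier S. is_sup (c \<otimes> j) ((\<lambda>f. c \<otimes> f) ` F) \<and> is_sup (j \<otimes> c) ((\<lambda>f. f \<otimes> c) ` F))"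
  using assms
proof (induction F rule: finite_induct)
  case empty
  then show ?case using is_sup_empty by (auto simp: zero)
next
  case (insert x F)
  then obtain j where j: "is_sup j F"
    and left: "\<And>c. c \<in> carrier S \<Longrightarrow> is_sup (c \<otimes> j) ((\<lambda>f. c \<otimes> f) ` F)"
    and right: "\<And>c. c \<in> carrier S \<Longrightarrow> is_sup (j \<otimes> c) ((\<lambda>f. f \<otimes> c) ` F)"
    by auto
  have x: "x \<in> carrier S" and F: "F \<subseteq> carrier S" using insert.prems by auto
  have jc: "j \<in> carrier S" using j by (rule is_sup_carrier)
  have fx: "f \<otimes> x\<^sup>\<dagger> \<in> E" "x\<^sup>\<dagger> \<otimes> f \<in> E" if "f \<in> F" for f
  proof -
    have "compatible S f x" "compatible S x f" using insert.prems(2) that by blast+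
    then show "f \<otimes> x\<^sup>\<dagger> \<in> E" "x\<^sup>\<dagger> \<otimes> f \<in> E" unfolding compatible_iff by blast+
  qed
  have "j \<otimes> x\<^sup>\<dagger> \<in> E" using fx x by (intro is_sup_idem[OF right]) auto
  moreover have "x\<^sup>\<dagger> \<otimes> j \<in> E" using fx x by (intro is_sup_idem[OF left]) auto
  then have "j\<^sup>\<dagger> \<otimes> x \<in> E" using left_compatible_sym[of "x\<^sup>\<dagger>" "j\<^sup>\<dagger>"] x jc by simp
  ultimately have jx: "compatible S j x" unfolding compatible_iff by blast
  obtain k where k: "is_sup k {j, x}" using compatible_join_exists[OF jc x jx] by blast
  have "is_sup (c \<otimes> k) ((\<lambda>f. c \<otimes> f) ` insert x F)" "is_sup (k \<otimes> c) ((\<lambda>f. f \<otimes> c) ` insert x F)"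
    if c: "c \<in> carrier S" for c
    using is_sup_insert[OF left[OF c] compatible_join_mult_left[OF jc x c jx k]]
      is_sup_insert[OF right[OF c] compatible_join_mult_right[OF jc x c jx k]] x c by auto
  then show ?case using is_sup_insert[OF j k x] by blast
qed

lemma finite_join_exists:
  assumes "finite F" "F \<subseteq> carrier S" "pairwise_compatible F"
  obtains j where "is_sup j F"
  using finite_join[OF assms] by blast

lemma finite_join_mult:
  assumes "is_sup j F" "finite F" "F \<subseteq> carrier S" "pairwise_compatible F" "c \<in> carrier S"
  shows "is_sup (c \<otimes> j) ((\<lambda>f. c \<otimes> f) ` F)" "is_sup (j \<otimes> c) ((\<lambda>f. f \<otimes> c) ` F)"
  using finite_join[OF assms(2-4)] is_sup_unique[OF assms(1)] assms(5) by blast+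

lemma inverse_mult_below:
  assumes "f \<preceq> j" "f \<in> carrier S" "j \<in> carrier S"
  shows "j\<^sup>\<dagger> \<otimes> f = f\<^sup>\<star>"
proof -
  obtain e where e: "e \<in> E" and f: "f = e \<otimes> j" using assms by (meson below_left_iff)
  show ?thesis using e assms(3) by (simp add: f inverse_mult m_assoc)
qed

text \<open>Since \<open>j\<^sup>\<dagger> \<otimes> f = f\<^sup>\<star>\<close> for \<open>f\<close> below \<open>j\<close>, this is distributivity for left multiplication by \<open>j\<^sup>\<dagger>\<close>.\<close>

lemma finite_join_domain:
  assumes "is_sup j F" "finite F" "F \<subseteq> carrier S" "pairwise_compatible F"
  shows "is_sup (j\<^sup>\<star>) ((\<lambda>f. f\<^sup>\<star>) ` F)"
proof -
  have j: "j \<in> carrier S" using assms(1) by (rule is_sup_carrier)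
  have "is_sup (j\<^sup>\<star>) ((\<lambda>f. j\<^sup>\<dagger> \<otimes> f) ` F)" using finite_join_mult(1)[OF assms inverse_closed[OF j]] .
  moreover have "(\<lambda>f. j\<^sup>\<dagger> \<otimes> f) ` F = (\<lambda>f. f\<^sup>\<star>) ` F"
    using assms(3) is_sup_upper[OF assms(1)] j by (intro image_cong) (auto intro: inverse_mult_below)
  ultimately show ?thesis by metis
qed

section \<open>Acceptable sets and their closure under finite joins\<close>

lemma acceptable_iff:
  "acceptable S A \<longleftrightarrow> A \<subseteq> carrier S \<and> (\<forall>a\<in>A. \<forall>b\<in>A. a \<otimes> b\<^sup>\<dagger> \<in> E) \<and>
    (\<forall>a\<in>A. \<forall>b\<in>carrier S. b \<preceq> a \<longrightarrow> b \<in> A)"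
proof (cases "A \<subseteq> carrier S")
  case True
  then have "left_compatible_set (inv_star S) A \<longleftrightarrow> (\<forall>a\<in>A. \<forall>b\<in>A. a \<otimes> b\<^sup>\<dagger> \<in> E)"
    unfolding left_compatible_set_def by (intro ball_cong refl left_compatible_iff) auto
  then show ?thesis by (simp add: acceptable_def)
qed (simp add: acceptable_def)

lemma acceptableI:
  assumes "A \<subseteq> carrier S" "\<And>a b. \<lbrakk>a \<in> A; b \<in> A\<rbrakk> \<Longrightarrow> a \<otimes> b\<^sup>\<dagger> \<in> E"
    "\<And>a b. \<lbrakk>a \<in> A; b \<in> carrier S; b \<preceq> a\<rbrakk> \<Longrightarrow> b \<in> A"
  shows "acceptable S A"
  using assms by (auto simp: acceptable_iff)

lemma acceptable_carrier: "acceptable S A \<Longrightarrow> A \<subseteq> carrier S"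
  and acceptable_left_compatible: "\<lbrakk>acceptable S A; a \<in> A; b \<in> A\<rbrakk> \<Longrightarrow> a \<otimes> b\<^sup>\<dagger> \<in> E"
  and acceptable_down: "\<lbrakk>acceptable S A; a \<in> A; b \<in> carrier S; b \<preceq> a\<rbrakk> \<Longrightarrow> b \<in> A"
  by (auto simp: acceptable_iff)

lemma nuI: "\<lbrakk>finite F; F \<subseteq> A; pairwise_compatible F; is_sup j F\<rbrakk> \<Longrightarrow> j \<in> nu S A"
  unfolding nu_def by blast

lemma nuE:
  assumes "j \<in> nu S A"
  obtains F where "finite F" "F \<subseteq> A" "pairwise_compatible F" "is_sup j F"
  using assms unfolding nu_def by blast

lemma nu_mono: "A \<subseteq> B \<Longrightarrow> nu S A \<subseteq> nu S B"
  by (intro subsetI, erule nuE, rule nuI) (assumption | erule order_trans)+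

lemma nu_carrier: "nu S A \<subseteq> carrier S"
  by (auto elim: nuE simp: is_sup_carrier)

lemma nu_extensive: "A \<subseteq> carrier S \<Longrightarrow> A \<subseteq> nu S A"
proof
  fix a assume "A \<subseteq> carrier S" "a \<in> A"
  then show "a \<in> nu S A"
    using compatible_refl[of a] is_sup_singleton[of a] by (intro nuI[of "{a}"]) auto
qed

lemma zero_in_nu: "zero \<in> nu S A"
  using nuI[of "{}" A zero] is_sup_empty by simp

text \<open>A left-compatibility condition \<open>x \<otimes> f\<^sup>\<dagger> \<in> E\<close> passes from the members of a finite compatible
  set to its join, since the join of a set of idempotents is idempotent.\<close>

lemma nu_left_compatible:
  assumes "A \<subseteq> carrier S" "B \<subseteq> carrier S" "\<And>a b. \<lbrakk>a \<in> A; b \<in> B\<rbrakk> \<Longrightarrow> a \<otimes> b\<^sup>\<dagger> \<in> E"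
    and "x \<in> nu S A" "y \<in> nu S B"
  shows "x \<otimes> y\<^sup>\<dagger> \<in> E"
proof -
  have step: "u \<otimes> v\<^sup>\<dagger> \<in> E"
    if D: "D \<subseteq> carrier S" "\<And>d. d \<in> D \<Longrightarrow> d \<otimes> v\<^sup>\<dagger> \<in> E" and u: "u \<in> nu S D" and v: "v \<in> carrier S"
    for u v D
  proof -
    obtain F where F: "finite F" "F \<subseteq> D" "pairwise_compatible F" "is_sup u F" using u by (rule nuE)
    have "is_sup (u \<otimes> v\<^sup>\<dagger>) ((\<lambda>f. f \<otimes> v\<^sup>\<dagger>) ` F)"
      using F D(1) v by (intro finite_join_mult(2)) auto
    then show ?thesis by (rule is_sup_idem) (use D(2) F(2) in auto)
  qed
  have x: "x \<in> carrier S" and y: "y \<in> carrier S" using assms(4,5) nu_carrier by auto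
  have "x \<otimes> b\<^sup>\<dagger> \<in> E" if "b \<in> B" for b
    using step[OF assms(1) _ assms(4)] assms(2,3) that by (metis subsetD)
  then have "b \<otimes> x\<^sup>\<dagger> \<in> E" if "b \<in> B" for b
    using left_compatible_sym[OF _ x] that assms(2) by (metis subsetD)
  then have "y \<otimes> x\<^sup>\<dagger> \<in> E" by (intro step[OF assms(2) _ assms(5) x])
  then show ?thesis using left_compatible_sym[OF _ y x] by simp
qed

lemma nu_down:
  assumes A: "acceptable S A" and y: "y \<in> nu S A" and x: "x \<in> carrier S" "x \<preceq> y"
  shows "x \<in> nu S A"
proof -
  obtain F where F: "finite F" "F \<subseteq> A" "pairwise_compatible F" "is_sup y F" using y by (rule nuE)
  have FC: "F \<subseteq> carrier S" using F(2) acceptable_carrier[OF A] by blast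
  have "is_sup (y \<otimes> x\<^sup>\<star>) ((\<lambda>f. f \<otimes> x\<^sup>\<star>) ` F)"
    using F FC x by (intro finite_join_mult(2)) auto
  then have "is_sup x ((\<lambda>f. f \<otimes> x\<^sup>\<star>) ` F)" using x(2) by (simp add: below_def)
  moreover have "(\<lambda>f. f \<otimes> x\<^sup>\<star>) ` F \<subseteq> A"
  proof (intro image_subsetI)
    fix f assume "f \<in> F"
    then have "f \<otimes> x\<^sup>\<star> \<preceq> f" "f \<in> A" "f \<in> carrier S" using x(1) F(2) FC by (auto intro: below_mult_idem)
    then show "f \<otimes> x\<^sup>\<star> \<in> A" using acceptable_down[OF A] x(1) by simp
  qed
  moreover have "pairwise_compatible ((\<lambda>f. f \<otimes> x\<^sup>\<star>) ` F)"
    using F(3) FC x(1) by (auto intro!: compatible_mult(1))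
  ultimately show ?thesis using F(1) by (intro nuI) auto
qed

lemma nu_acceptable:
  assumes A: "acceptable S A"
  shows "acceptable S (nu S A)"
proof (rule acceptableI)
  show "nu S A \<subseteq> carrier S" by (rule nu_carrier)
  show "a \<otimes> b\<^sup>\<dagger> \<in> E" if "a \<in> nu S A" "b \<in> nu S A" for a b
    using nu_left_compatible[OF acceptable_carrier[OF A] acceptable_carrier[OF A]]
      acceptable_left_compatible[OF A] that by blast
  show "b \<in> nu S A" if "a \<in> nu S A" "b \<in> carrier S" "b \<preceq> a" for a b
    using nu_down[OF A] that by blast
qed

text \<open>Flattening a finite join of finite joins: members of the different inner sets are compatible
  because they lie below compatible elements.\<close>

lemma nu_nu:
  assumes AC: "A \<subseteq> carrier S"
  shows "nu S (nu S A) = nu S A"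
proof
  show "nu S A \<subseteq> nu S (nu S A)" by (rule nu_extensive[OF nu_carrier])
  show "nu S (nu S A) \<subseteq> nu S A"
  proof
    fix x assume "x \<in> nu S (nu S A)"
    then obtain G where G: "finite G" "G \<subseteq> nu S A" "pairwise_compatible G" "is_sup x G" by (rule nuE)
    have "\<exists>F. finite F \<and> F \<subseteq> A \<and> is_sup g F" if "g \<in> G" for g
      using nuE[OF subsetD[OF G(2) that]] by metis
    then obtain \<Phi> where \<Phi>: "\<And>g. g \<in> G \<Longrightarrow> finite (\<Phi> g)" "\<And>g. g \<in> G \<Longrightarrow> \<Phi> g \<subseteq> A"
      "\<And>g. g \<in> G \<Longrightarrow> is_sup g (\<Phi> g)"
      by metis
    have GC: "g \<in> carrier S" if "g \<in> G" for g using that G(2) nu_carrier by (metis subsetD)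
    have \<Phi>C: "a \<in> carrier S" "a \<preceq> g" if "a \<in> \<Phi> g" "g \<in> G" for a g
    proof -
      show "a \<in> carrier S" using that \<Phi>(2) AC by (metis subsetD)
      then show "a \<preceq> g" using is_sup_upper[OF \<Phi>(3)[OF that(2)] that(1)] by simp
    qed
    let ?F = "\<Union>(\<Phi> ` G)"
    have "compatible S a b" if ab: "a \<in> ?F" "b \<in> ?F" for a b
    proof -
      obtain g h where gh: "g \<in> G" "a \<in> \<Phi> g" "h \<in> G" "b \<in> \<Phi> h" using ab by (elim UN_E)
      have "compatible S g h" using G(3) gh by simp
      then show ?thesis
        using \<Phi>C[OF gh(2,1)] \<Phi>C[OF gh(4,3)] GC gh by (intro compatible_below[of g h a b]) auto
    qed
    moreover have "is_sup x ?F"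
    proof (rule is_supI)
      show xC: "x \<in> carrier S" using G(4) by (rule is_sup_carrier)
      show "a \<preceq> x" if a: "a \<in> ?F" "a \<in> carrier S" for a
      proof -
        obtain g where g: "g \<in> G" "a \<in> \<Phi> g" using a(1) by (elim UN_E)
        show ?thesis
          using below_trans[OF \<Phi>C(2)[OF g(2,1)] is_sup_upper[OF G(4) g(1) GC[OF g(1)]]] a(2) GC[OF g(1)] xC
          by simp
      qed
      show "x \<preceq> y" if y: "y \<in> carrier S" "\<And>a. \<lbrakk>a \<in> ?F; a \<in> carrier S\<rbrakk> \<Longrightarrow> a \<preceq> y" for y
        by (rule is_sup_least[OF G(4) y(1)], rule is_sup_least[OF \<Phi>(3) y(1)]) (auto intro: y(2))
    qed
    moreover have "finite ?F" using G(1) \<Phi>(1) by simp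
    moreover have "?F \<subseteq> A" using \<Phi>(2) by (simp add: UN_least)
    ultimately show "x \<in> nu S A" by (intro nuI) auto
  qed
qed

lemma nu_nu_un:
  assumes "A \<subseteq> carrier S" "B \<subseteq> nu S A"
  shows "nu S B \<subseteq> nu S A"
  using nu_mono[OF assms(2)] nu_nu[OF assms(1)] by simp

end

section \<open>Products and domains of acceptable sets\<close>

context boolean_inverse_monoid
begin

abbreviation domains
  where "domains A \<equiv> (\<lambda>a. a\<^sup>\<star>) ` A"

lemma set_multI: "\<lbrakk>a \<in> A; b \<in> B\<rbrakk> \<Longrightarrow> a \<otimes> b \<in> A <#> B"
  and set_multE: "\<lbrakk>x \<in> A <#> B; \<And>a b. \<lbrakk>a \<in> A; b \<in> B; x = a \<otimes> b\<rbrakk> \<Longrightarrow> P\<rbrakk> \<Longrightarrow> P"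

  by (auto simp: set_mult_def)

lemma set_mult_assoc_subsets:
  assumes "A \<subseteq> carrier S" "B \<subseteq> carrier S" "D \<subseteq> carrier S"
  shows "(A <#> B) <#> D = A <#> (B <#> D)"
  using assms by (fastforce simp: set_mult_def m_assoc subset_iff)

lemma idem_ideal_acceptable:
  assumes "A \<subseteq> E" "\<And>a b. \<lbrakk>a \<in> A; b \<in> E; b \<preceq> a\<rbrakk> \<Longrightarrow> b \<in> A"
  shows "acceptable S A"
proof (rule acceptableI)
  show "A \<subseteq> carrier S" using assms(1) by auto
  show "a \<otimes> b\<^sup>\<dagger> \<in> E" if "a \<in> A" "b \<in> A" for a b
  proof -
    have "a \<in> E" "b \<in> E" using that assms(1) by auto
    then show ?thesis by simp
  qed
  show "b \<in> A" if "a \<in> A" "b \<in> carrier S" "b \<preceq> a" for a b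
    using assms(2)[OF that(1) below_idem[OF that(3) subsetD[OF assms(1) that(1)] that(2)] that(3)] .
qed

lemma nu_idems: "A \<subseteq> E \<Longrightarrow> nu S A \<subseteq> E"
  using is_sup_idem by (metis nuE order_trans subsetI)

text \<open>Left compatibility of \<open>a \<otimes> b\<close> and \<open>c \<otimes> d\<close> reduces to that of \<open>A\<close>: the middle factor \<open>b \<otimes> d\<^sup>\<dagger>\<close> is
  idempotent, so it merely restricts \<open>a\<close> to a smaller member of \<open>A\<close>.\<close>

lemma mult_acceptable:
  assumes A: "acceptable S A" and B: "acceptable S B"
  shows "acceptable S (A <#> B)"
proof (rule acceptableI)
  note AC = subsetD[OF acceptable_carrier[OF A]] and BC = subsetD[OF acceptable_carrier[OF B]]
  show "A <#> B \<subseteq> carrier S" using AC BC by (auto elim!: set_multE)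
  show "x \<otimes> y\<^sup>\<dagger> \<in> E" if "x \<in> A <#> B" "y \<in> A <#> B" for x y
  proof -
    obtain a b c d where x: "a \<in> A" "b \<in> B" "x = a \<otimes> b" and y: "c \<in> A" "d \<in> B" "y = c \<otimes> d"
      using \<open>x \<in> A <#> B\<close> \<open>y \<in> A <#> B\<close> by (elim set_multE)
    have C: "a \<in> carrier S" "b \<in> carrier S" "c \<in> carrier S" "d \<in> carrier S" using x y AC BC by auto
    have bd: "b \<otimes> d\<^sup>\<dagger> \<in> E" using acceptable_left_compatible[OF B x(2) y(2)] .
    have "a \<otimes> (b \<otimes> d\<^sup>\<dagger>) \<preceq> a" using C bd by (intro below_mult_idem) auto
    then have "a \<otimes> (b \<otimes> d\<^sup>\<dagger>) \<in> A" using C by (intro acceptable_down[OF A x(1)]) auto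
    then have "a \<otimes> (b \<otimes> d\<^sup>\<dagger>) \<otimes> c\<^sup>\<dagger> \<in> E" using acceptable_left_compatible[OF A] y(1) by simp
    also have "a \<otimes> (b \<otimes> d\<^sup>\<dagger>) \<otimes> c\<^sup>\<dagger> = x \<otimes> y\<^sup>\<dagger>" using C by (simp add: x y inverse_mult m_assoc)
    finally show ?thesis .
  qed
  show "y \<in> A <#> B" if "x \<in> A <#> B" "y \<in> carrier S" "y \<preceq> x" for x y
  proof -
    obtain a b where x: "a \<in> A" "b \<in> B" "x = a \<otimes> b" using \<open>x \<in> A <#> B\<close> by (elim set_multE)
    have C: "a \<in> carrier S" "b \<in> carrier S" using x AC BC by auto
    have "b \<otimes> y\<^sup>\<star> \<preceq> b" using C \<open>y \<in> carrier S\<close> by (intro below_mult_idem) auto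
    then have "b \<otimes> y\<^sup>\<star> \<in> B" using C \<open>y \<in> carrier S\<close> by (intro acceptable_down[OF B x(2)]) auto
    then have "a \<otimes> (b \<otimes> y\<^sup>\<star>) \<in> A <#> B" using x(1) by (rule set_multI[rotated])
    also have "a \<otimes> (b \<otimes> y\<^sup>\<star>) = x \<otimes> y\<^sup>\<star>" using C \<open>y \<in> carrier S\<close> by (simp add: x m_assoc)
    also have "\<dots> = y" using \<open>y \<preceq> x\<close> by (simp only: below_def)
    finally show ?thesis .
  qed
qed

lemma domain_mult_idem:
  assumes "a \<in> carrier S" "e \<in> E"
  shows "(a \<otimes> e)\<^sup>\<star> = a\<^sup>\<star> \<otimes> e"
proof -
  have "(a \<otimes> e)\<^sup>\<star> = e \<otimes> (a\<^sup>\<star> \<otimes> e)" using assms by (simp add: inverse_mult m_assoc)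
  also have "a\<^sup>\<star> \<otimes> e = e \<otimes> a\<^sup>\<star>" using assms by (intro idem_commute) auto
  also have "e \<otimes> (e \<otimes> a\<^sup>\<star>) = e \<otimes> a\<^sup>\<star>" using assms by simp
  also have "e \<otimes> a\<^sup>\<star> = a\<^sup>\<star> \<otimes> e" using assms by (intro idem_commute) auto
  finally show ?thesis .
qed

lemma domains_idems: "A \<subseteq> carrier S \<Longrightarrow> domains A \<subseteq> E"
  by auto

lemma domains_acceptable:
  assumes A: "acceptable S A"
  shows "acceptable S (domains A)"
proof (rule idem_ideal_acceptable)
  note AC = subsetD[OF acceptable_carrier[OF A]]
  show "domains A \<subseteq> E" using acceptable_carrier[OF A] by (rule domains_idems)
  fix x e assume "x \<in> domains A" and e: "e \<in> E" "e \<preceq> x"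
  then obtain a where a: "a \<in> A" "x = a\<^sup>\<star>" by auto
  have aC: "a \<in> carrier S" using a AC by auto
  have "a \<otimes> e \<in> A" using below_mult_idem(1)[OF aC e(1)] a aC e(1) by (intro acceptable_down[OF A a(1)]) auto
  then have "(a \<otimes> e)\<^sup>\<star> \<in> domains A" by (rule imageI)
  moreover have "(a \<otimes> e)\<^sup>\<star> = e"
  proof -
    have "a\<^sup>\<star> \<otimes> e\<^sup>\<star> = e"
      using below_domain_mult[OF e(2) idem_carrier[OF e(1)]] domain_closed[OF aC] unfolding a by simp
    moreover have "e\<^sup>\<star> = e" using e(1) by simp
    ultimately show ?thesis using domain_mult_idem[OF aC e(1)] by metis
  qed
  ultimately show "e \<in> domains A" by (simp only:)
qed

lemma domains_of_idems: "A \<subseteq> E \<Longrightarrow> domains A = A"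
proof -
  assume "A \<subseteq> E"
  then have "domains A = (\<lambda>a. a) ` A" by (intro image_cong) auto
  then show ?thesis by simp
qed

section \<open>Compatibility of the closure with products and domains\<close>

text \<open>A product of two finite joins is expanded one factor at a time; this gives a finite join of
  finite joins, which flattens.\<close>

lemma nu_mult_subset:
  assumes A: "acceptable S A" and B: "acceptable S B"
  shows "nu S A <#> nu S B \<subseteq> nu S (A <#> B)"
proof
  note AC = acceptable_carrier[OF A] and BC = acceptable_carrier[OF B]
  have ABC: "A <#> B \<subseteq> carrier S" using acceptable_carrier[OF mult_acceptable[OF A B]] .
  have left: "x \<otimes> b \<in> nu S (A <#> B)" if x: "x \<in> nu S A" and b: "b \<in> B" for x b
  proof -
    obtain F where F: "finite F" "F \<subseteq> A" "pairwise_compatible F" "is_sup x F" using x by (rule nuE)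
    have bC: "b \<in> carrier S" and FC: "F \<subseteq> carrier S" using b BC F(2) AC by auto
    show ?thesis
    proof (rule nuI)
      show "is_sup (x \<otimes> b) ((\<lambda>f. f \<otimes> b) ` F)" by (rule finite_join_mult(2)[OF F(4,1) FC F(3) bC])
      show "(\<lambda>f. f \<otimes> b) ` F \<subseteq> A <#> B" using F(2) b by (auto intro: set_multI)
      show "pairwise_compatible ((\<lambda>f. f \<otimes> b) ` F)"
        using F(3) FC bC by (auto intro!: compatible_mult(1))
    qed (use F in simp)
  qed
  fix z assume "z \<in> nu S A <#> nu S B"
  then obtain x y where z: "x \<in> nu S A" "y \<in> nu S B" "z = x \<otimes> y" by (elim set_multE)
  obtain F where F: "finite F" "F \<subseteq> B" "pairwise_compatible F" "is_sup y F" using z(2) by (rule nuE)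
  have xC: "x \<in> carrier S" and FC: "F \<subseteq> carrier S" using z(1) nu_carrier BC F(2) by auto
  have "x \<otimes> y \<in> nu S (nu S (A <#> B))"
  proof (rule nuI)
    show "is_sup (x \<otimes> y) ((\<lambda>f. x \<otimes> f) ` F)" by (rule finite_join_mult(1)[OF F(4,1) FC F(3) xC])
    show "(\<lambda>f. x \<otimes> f) ` F \<subseteq> nu S (A <#> B)" using F(2) left[OF z(1)] by auto
    show "pairwise_compatible ((\<lambda>f. x \<otimes> f) ` F)"
      using F(3) FC xC by (auto intro!: compatible_mult(2))
  qed (use F in simp)
  then show "z \<in> nu S (A <#> B)" by (simp add: z nu_nu[OF ABC])
qed

lemma nu_mult:
  assumes A: "acceptable S A" and B: "acceptable S B"
  shows "nu S (nu S A <#> B) = nu S (A <#> B)" "nu S (A <#> nu S B) = nu S (A <#> B)"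
proof -
  note AC = acceptable_carrier[OF A] and BC = acceptable_carrier[OF B]
  have ABC: "A <#> B \<subseteq> carrier S" using acceptable_carrier[OF mult_acceptable[OF A B]] .
  have "nu S (A' <#> B') = nu S (A <#> B)"
    if "A \<subseteq> A'" "A' \<subseteq> nu S A" "B \<subseteq> B'" "B' \<subseteq> nu S B" for A' B'
  proof (rule antisym)
    have "A' <#> B' \<subseteq> nu S (A <#> B)" by (rule order_trans[OF mono_set_mult[OF that(2,4)] nu_mult_subset[OF A B]])
    then show "nu S (A' <#> B') \<subseteq> nu S (A <#> B)" by (rule nu_nu_un[OF ABC])
    show "nu S (A <#> B) \<subseteq> nu S (A' <#> B')" by (rule nu_mono[OF mono_set_mult[OF that(1,3)]])
  qed
  from this[of "nu S A" B] this[of A "nu S B"] nu_extensive[OF AC] nu_extensive[OF BC]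
  show "nu S (nu S A <#> B) = nu S (A <#> B)" "nu S (A <#> nu S B) = nu S (A <#> B)" by simp_all
qed

lemma nu_domains:
  assumes A: "acceptable S A"
  shows "nu S (domains (nu S A)) = nu S (domains A)"
proof (rule antisym)
  note AC = acceptable_carrier[OF A]
  have DC: "domains A \<subseteq> carrier S" using AC by auto
  have "domains (nu S A) \<subseteq> nu S (domains A)"
  proof (intro image_subsetI)
    fix x assume "x \<in> nu S A"
    then obtain F where F: "finite F" "F \<subseteq> A" "pairwise_compatible F" "is_sup x F" by (rule nuE)
    have FC: "F \<subseteq> carrier S" using F(2) AC by simp
    show "x\<^sup>\<star> \<in> nu S (domains A)"
    proof (rule nuI)
      show "is_sup (x\<^sup>\<star>) (domains F)" by (rule finite_join_domain[OF F(4,1) FC F(3)])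
      show "domains F \<subseteq> domains A" using F(2) by auto
      show "pairwise_compatible (domains F)" using FC by (auto intro!: compatible_idem)
    qed (use F in simp)
  qed
  then show "nu S (domains (nu S A)) \<subseteq> nu S (domains A)" by (rule nu_nu_un[OF DC])
  show "nu S (domains A) \<subseteq> nu S (domains (nu S A))"
    by (rule nu_mono[OF image_mono[OF nu_extensive[OF AC]]])
qed

section \<open>The restriction identities for sets\<close>

lemma left_compatible_swap:
  assumes "a \<otimes> b\<^sup>\<dagger> \<in> E" "a \<in> carrier S" "b \<in> carrier S"
  shows "a \<otimes> b\<^sup>\<star> = b \<otimes> a\<^sup>\<star>"
  using assms left_compatible_iff[of a b] by (simp add: left_compatible_def)

lemma mult_idems_subset:
  assumes A: "acceptable S A" and D: "D \<subseteq> E"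
  shows "A <#> D \<subseteq> A" "D <#> A \<subseteq> A"
proof -
  note AC = subsetD[OF acceptable_carrier[OF A]] and DE = subsetD[OF D]
  have "a \<otimes> d \<in> A" "d \<otimes> a \<in> A" if "a \<in> A" "d \<in> D" for a d
    using below_mult_idem[OF AC[OF that(1)] DE[OF that(2)]] AC[OF that(1)] DE[OF that(2)]
      acceptable_down[OF A that(1)] by simp_all
  then show "A <#> D \<subseteq> A" "D <#> A \<subseteq> A" by (auto elim!: set_multE)
qed

text \<open>The case \<open>A = B\<close> is RR4 for sets; in general this identity makes inclusion the natural order.
  An element \<open>b \<otimes> a\<^sup>\<star>\<close> of the product is in \<open>A\<close> because left compatibility rewrites it to the
  restriction \<open>a \<otimes> b\<^sup>\<star>\<close> of \<open>a\<close>.\<close>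

lemma mult_domains:
  assumes B: "acceptable S B" and A: "acceptable S A" "A \<subseteq> B"
  shows "B <#> domains A = A"
proof
  note BC = subsetD[OF acceptable_carrier[OF B]] and AC = subsetD[OF acceptable_carrier[OF A(1)]]
  show "B <#> domains A \<subseteq> A"
  proof
    fix x assume "x \<in> B <#> domains A"
    then obtain b a where x: "b \<in> B" "a \<in> A" "x = b \<otimes> a\<^sup>\<star>" by (auto elim!: set_multE)
    have "b \<otimes> a\<^sup>\<star> = a \<otimes> b\<^sup>\<star>"
      using acceptable_left_compatible[OF B x(1) subsetD[OF A(2) x(2)]] BC[OF x(1)] AC[OF x(2)]
      by (intro left_compatible_swap)
    moreover have "a \<otimes> b\<^sup>\<star> \<preceq> a" using BC[OF x(1)] AC[OF x(2)] by (intro below_mult_idem) auto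
    ultimately show "x \<in> A" using BC[OF x(1)] AC[OF x(2)] by (simp add: x acceptable_down[OF A(1) x(2)])
  qed
  show "A \<subseteq> B <#> domains A"
  proof
    fix a assume a: "a \<in> A"
    then have "a \<otimes> a\<^sup>\<star> \<in> B <#> domains A" using A(2) by (intro set_multI) auto
    then show "a \<in> B <#> domains A" using AC[OF a] by simp
  qed
qed

lemma domain_mult: "\<lbrakk>a \<in> carrier S; b \<in> carrier S\<rbrakk> \<Longrightarrow> (a\<^sup>\<star> \<otimes> b)\<^sup>\<star> = (a \<otimes> b)\<^sup>\<star>"
  by (simp add: inverse_mult m_assoc)

lemma domains_mult:
  assumes "A \<subseteq> carrier S" "B \<subseteq> carrier S"
  shows "domains (domains A <#> B) = domains (A <#> B)"
proof -
  have "domains (domains A <#> B) = (\<Union>a\<in>A. \<Union>b\<in>B. {(a\<^sup>\<star> \<otimes> b)\<^sup>\<star>})"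
    unfolding set_mult_def by blast
  also have "\<dots> = (\<Union>a\<in>A. \<Union>b\<in>B. {(a \<otimes> b)\<^sup>\<star>})"
    using assms by (intro SUP_cong refl arg_cong[where f = "\<lambda>x. {x}"] domain_mult) auto
  also have "\<dots> = domains (A <#> B)" unfolding set_mult_def by blast
  finally show ?thesis .
qed

text \<open>In RR6 the two occurrences of \<open>A\<close> on the right-hand side \<open>A (B A)\<^sup>*\<close> range over different
  elements; left compatibility of \<open>A\<close> allows one to exchange them.\<close>

lemma domains_past:
  assumes A: "acceptable S A" and B: "B \<subseteq> carrier S"
  shows "domains B <#> A = A <#> domains (B <#> A)"
proof
  note AC = subsetD[OF acceptable_carrier[OF A]] and BC = subsetD[OF B]
  have past: "b\<^sup>\<star> \<otimes> a = a \<otimes> (b \<otimes> a)\<^sup>\<star>" if "a \<in> carrier S" "b \<in> carrier S" for a b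
    using idem_past(1)[OF that(1) domain_idem[OF that(2)]] that by (simp add: inverse_mult m_assoc)
  show "domains B <#> A \<subseteq> A <#> domains (B <#> A)"
  proof
    fix x assume "x \<in> domains B <#> A"
    then obtain b a where x: "b \<in> B" "a \<in> A" "x = b\<^sup>\<star> \<otimes> a" by (auto elim!: set_multE)
    have "a \<otimes> (b \<otimes> a)\<^sup>\<star> \<in> A <#> domains (B <#> A)" using x by (intro set_multI imageI)
    then show "x \<in> A <#> domains (B <#> A)" using past AC[OF x(2)] BC[OF x(1)] by (simp only: x)
  qed
  show "A <#> domains (B <#> A) \<subseteq> domains B <#> A"
  proof
    fix x assume "x \<in> A <#> domains (B <#> A)"
    then obtain c b a where x: "c \<in> A" "b \<in> B" "a \<in> A" "x = c \<otimes> (b \<otimes> a)\<^sup>\<star>"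
      by (auto elim!: set_multE)
    have C: "a \<in> carrier S" "b \<in> carrier S" "c \<in> carrier S" using x AC BC by auto
    have "(b \<otimes> a)\<^sup>\<star> = a\<^sup>\<star> \<otimes> (b \<otimes> a)\<^sup>\<star>" using C by (simp add: inverse_mult m_assoc)
    then have "x = c \<otimes> a\<^sup>\<star> \<otimes> (b \<otimes> a)\<^sup>\<star>" using C by (simp add: x m_assoc)
    also have "c \<otimes> a\<^sup>\<star> = a \<otimes> c\<^sup>\<star>"
      using acceptable_left_compatible[OF A x(1,3)] C by (intro left_compatible_swap)
    also have "a \<otimes> c\<^sup>\<star> \<otimes> (b \<otimes> a)\<^sup>\<star> = a \<otimes> (c\<^sup>\<star> \<otimes> (b \<otimes> a)\<^sup>\<star>)" using C by (simp add: m_assoc)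
    also have "c\<^sup>\<star> \<otimes> (b \<otimes> a)\<^sup>\<star> = (b \<otimes> a)\<^sup>\<star> \<otimes> c\<^sup>\<star>" using C by (intro idem_commute) auto
    also have "a \<otimes> ((b \<otimes> a)\<^sup>\<star> \<otimes> c\<^sup>\<star>) = a \<otimes> (b \<otimes> a)\<^sup>\<star> \<otimes> c\<^sup>\<star>" using C by (simp add: m_assoc)
    also have "a \<otimes> (b \<otimes> a)\<^sup>\<star> = b\<^sup>\<star> \<otimes> a" using past C by simp
    also have "b\<^sup>\<star> \<otimes> a \<otimes> c\<^sup>\<star> = b\<^sup>\<star> \<otimes> (a \<otimes> c\<^sup>\<star>)" using C by (simp add: m_assoc)
    finally have "x = b\<^sup>\<star> \<otimes> (a \<otimes> c\<^sup>\<star>)" .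
    moreover have "a \<otimes> c\<^sup>\<star> \<in> A"
      using below_mult_idem(1)[OF C(1) domain_idem[OF C(3)]] C by (intro acceptable_down[OF A x(3)]) auto
    ultimately show "x \<in> domains B <#> A" using x(2) by (simp add: set_multI)
  qed
qed

end

section \<open>The natural order and joins of closed acceptable sets\<close>

context boolean_inverse_monoid
begin

abbreviation nu_sets (\<open>\<N>\<close>)
  where "\<N> \<equiv> carrier (R_nu S)"

text \<open>Taking \<open>C\<close> to be all closed sets or the finitely generated ones yields \<open>R(S)\<^sub>\<nu>\<close> and \<open>Etale(S)\<close>, so
  that joins and the right restriction axioms are treated for both at once.\<close>

abbreviation R_nu_on
  where "R_nu_on C \<equiv> (R_nu S)\<lparr>carrier := C\<rparr>"

lemma nu_sets_iff: "A \<in> \<N> \<longleftrightarrow> acceptable S A \<and> nu S A = A"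
  by (simp add: R_nu_def R_monoid_def)

lemma nu_setsD: "A \<in> \<N> \<Longrightarrow> acceptable S A" "A \<in> \<N> \<Longrightarrow> nu S A = A"
  by (simp_all add: nu_sets_iff)

lemma nu_in_nu_sets: "acceptable S A \<Longrightarrow> nu S A \<in> \<N>"
  by (simp add: nu_sets_iff nu_acceptable nu_nu acceptable_carrier)

lemma R_nu_ops [simp]:
  "mult (R_nu S) A B = nu S (A <#> B)" "one (R_nu S) = E" "star (R_nu S) A = nu S (domains A)"
  by (simp_all add: R_nu_def R_monoid_def)

lemma R_nu_on_simps:
  "carrier (R_nu_on C) = C" "mult (R_nu_on C) A B = nu S (A <#> B)" "one (R_nu_on C) = E"
  "star (R_nu_on C) A = nu S (domains A)"
  by simp_all

lemma mult_nu_domains: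
  assumes "A \<in> \<N>" "B \<in> \<N>"
  shows "nu S (B <#> nu S (domains A)) = nu S (B <#> domains A)"
  using assms by (intro nu_mult(2) domains_acceptable nu_setsD)

text \<open>Multiplying a closed set \<open>B\<close> by idempotents and closing again stays inside \<open>B\<close>; this gives the
  forward direction here and for left compatibility below. Conversely \<open>B A\<^sup>\<star> = A\<close> for \<open>A \<subseteq> B\<close>.\<close>

lemma nat_le_R_nu_on_iff:
  assumes A: "A \<in> \<N>" and B: "B \<in> \<N>"
  shows "nat_le (R_nu_on C) A B \<longleftrightarrow> A \<subseteq> B"
proof -
  note accA = nu_setsD(1)[OF A] and accB = nu_setsD(1)[OF B]
  have "nat_le (R_nu_on C) A B \<longleftrightarrow> A = nu S (B <#> domains A)"
    by (simp add: nat_le_def mult_nu_domains[OF A B])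
  also have "\<dots> \<longleftrightarrow> A \<subseteq> B"
  proof
    assume eq: "A = nu S (B <#> domains A)"
    have "B <#> domains A \<subseteq> B"
      using mult_idems_subset(1)[OF accB domains_idems[OF acceptable_carrier[OF accA]]] .
    then have "nu S (B <#> domains A) \<subseteq> B" using nu_mono[of _ B] nu_setsD(2)[OF B] by metis
    then show "A \<subseteq> B" using eq by metis
  next
    assume "A \<subseteq> B"
    then show "A = nu S (B <#> domains A)"
      by (simp only: mult_domains[OF accB accA] nu_setsD(2)[OF A])
  qed
  finally show ?thesis .
qed

lemma left_compatible_R_nu_on_iff:
  assumes A: "A \<in> \<N>" and B: "B \<in> \<N>"
  shows "left_compatible (R_nu_on C) A B \<longleftrightarrow> (\<forall>a\<in>A. \<forall>b\<in>B. a \<otimes> b\<^sup>\<dagger> \<in> E)"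
proof -
  note accA = nu_setsD(1)[OF A] and accB = nu_setsD(1)[OF B]
  note AC = subsetD[OF acceptable_carrier[OF accA]] and BC = subsetD[OF acceptable_carrier[OF accB]]
  have "left_compatible (R_nu_on C) A B \<longleftrightarrow> nu S (A <#> domains B) = nu S (B <#> domains A)"
    by (simp add: left_compatible_def mult_nu_domains[OF A B] mult_nu_domains[OF B A])
  also have "\<dots> \<longleftrightarrow> (\<forall>a\<in>A. \<forall>b\<in>B. a \<otimes> b\<^sup>\<dagger> \<in> E)"
  proof
    assume eq: "nu S (A <#> domains B) = nu S (B <#> domains A)"
    show "\<forall>a\<in>A. \<forall>b\<in>B. a \<otimes> b\<^sup>\<dagger> \<in> E"
    proof (intro ballI)
      fix a b assume a: "a \<in> A" and b: "b \<in> B"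
      have AB: "A <#> domains B \<subseteq> carrier S"
        using acceptable_carrier[OF mult_acceptable[OF accA domains_acceptable[OF accB]]] .
      have "a \<otimes> b\<^sup>\<star> \<in> nu S (A <#> domains B)"
        by (rule subsetD[OF nu_extensive[OF AB] set_multI[OF a imageI[OF b]]])
      also have "\<dots> = nu S (B <#> domains A)" by (rule eq)
      also have "\<dots> \<subseteq> nu S B"
        using mult_idems_subset(1)[OF accB domains_idems[OF acceptable_carrier[OF accA]]] by (rule nu_mono)
      also have "\<dots> = B" using B by (rule nu_setsD(2))
      finally have "a \<otimes> b\<^sup>\<star> \<otimes> b\<^sup>\<dagger> \<in> E" using acceptable_left_compatible[OF accB] b by simp
      also have "a \<otimes> b\<^sup>\<star> \<otimes> b\<^sup>\<dagger> = a \<otimes> b\<^sup>\<dagger>" using AC[OF a] BC[OF b] by (simp add: m_assoc)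
      finally show "a \<otimes> b\<^sup>\<dagger> \<in> E" .
    qed
  next
    assume lc: "\<forall>a\<in>A. \<forall>b\<in>B. a \<otimes> b\<^sup>\<dagger> \<in> E"
    have swap: "a \<otimes> b\<^sup>\<star> = b \<otimes> a\<^sup>\<star>" if "a \<in> A" "b \<in> B" for a b
      using lc that AC BC by (intro left_compatible_swap) simp_all
    have "A <#> domains B = (\<Union>a\<in>A. \<Union>b\<in>B. {a \<otimes> b\<^sup>\<star>})" by (simp add: set_mult_def)
    also have "\<dots> = (\<Union>a\<in>A. \<Union>b\<in>B. {b \<otimes> a\<^sup>\<star>})"
      by (intro SUP_cong refl arg_cong[where f = "\<lambda>x. {x}"] swap)
    also have "\<dots> = (\<Union>b\<in>B. \<Union>a\<in>A. {b \<otimes> a\<^sup>\<star>})" by (rule SUP_commute)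
    also have "\<dots> = B <#> domains A" by (simp add: set_mult_def)
    finally show "nu S (A <#> domains B) = nu S (B <#> domains A)" by (simp only:)
  qed
  finally show ?thesis .
qed

lemma is_join_R_nu_on_iff:
  assumes "C \<subseteq> \<N>"
  shows "is_join (R_nu_on C) J X \<longleftrightarrow>
    J \<in> C \<and> (\<forall>A\<in>X \<inter> C. A \<subseteq> J) \<and> (\<forall>Y\<in>C. (\<forall>A\<in>X \<inter> C. A \<subseteq> Y) \<longrightarrow> J \<subseteq> Y)"
proof -
  have "nat_le (R_nu_on C) A B \<longleftrightarrow> A \<subseteq> B" if "A \<in> C" "B \<in> C" for A B
    using that assms by (intro nat_le_R_nu_on_iff) auto
  then show ?thesis unfolding is_join_iff R_nu_on_simps by auto
qed

lemma is_join_R_nu_on_unique: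
  assumes "C \<subseteq> \<N>" "is_join (R_nu_on C) J X" "is_join (R_nu_on C) K X"
  shows "J = K"
  using assms(2,3) unfolding is_join_R_nu_on_iff[OF assms(1)] by (metis subset_antisym)

lemma nu_Union_is_join:
  assumes C: "C \<subseteq> \<N>" and X: "X \<subseteq> C" and J: "nu S (\<Union>X) \<in> C"
  shows "is_join (R_nu_on C) (nu S (\<Union>X)) X"
  unfolding is_join_R_nu_on_iff[OF C]
proof (intro conjI J ballI impI)
  have XC: "\<Union>X \<subseteq> carrier S"
  proof (rule Union_least)
    fix A assume "A \<in> X"
    then have "A \<in> \<N>" using X C by (metis subsetD)
    then show "A \<subseteq> carrier S" by (intro acceptable_carrier nu_setsD(1))
  qed
  show "A \<subseteq> nu S (\<Union>X)" if "A \<in> X \<inter> C" for A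
    using that nu_extensive[OF XC] by (meson IntD1 Union_upper order_trans)
  show "nu S (\<Union>X) \<subseteq> Y" if Y: "Y \<in> C" "\<forall>A\<in>X \<inter> C. A \<subseteq> Y" for Y
  proof -
    have "\<Union>X \<subseteq> Y" using Y(2) X by (intro Union_least) auto
    then have "nu S (\<Union>X) \<subseteq> nu S Y" by (rule nu_mono)
    moreover have "nu S Y = Y" using Y(1) C by (intro nu_setsD(2)) auto
    ultimately show ?thesis by (simp only:)
  qed
qed

lemma left_compatible_Union_acceptable:
  assumes X: "X \<subseteq> \<N>" and lc: "left_compatible_set (R_nu_on C) X"
  shows "acceptable S (\<Union>X)"
proof (rule acceptableI)
  have acc: "acceptable S A" if "A \<in> X" for A using that X by (intro nu_setsD(1)) auto
  show "\<Union>X \<subseteq> carrier S" using acc acceptable_carrier by (metis Union_least)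
  show "a \<otimes> b\<^sup>\<dagger> \<in> E" if ab: "a \<in> \<Union>X" "b \<in> \<Union>X" for a b
  proof -
    obtain A B where AB: "A \<in> X" "a \<in> A" "B \<in> X" "b \<in> B" using ab by (elim UnionE)
    then have "left_compatible (R_nu_on C) A B" using lc by (simp add: left_compatible_set_def)
    then show ?thesis using AB X left_compatible_R_nu_on_iff[of A B C] by (metis subsetD)
  qed
  show "b \<in> \<Union>X" if b: "a \<in> \<Union>X" "b \<in> carrier S" "b \<preceq> a" for a b
  proof -
    obtain A where A: "A \<in> X" "a \<in> A" using b(1) by (elim UnionE)
    show ?thesis using acceptable_down[OF acc[OF A(1)] A(2) b(2,3)] A(1) by (rule UnionI[rotated])
  qed
qed

text \<open>The identities hold for plain products and sets of domains. They survive the closure because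
  closing a factor, or the set whose domains are formed, does not change the closed result.\<close>

lemma R_nu_on_right_restriction_monoid:
  assumes C: "C \<subseteq> \<N>" and one: "E \<in> C"
    and mult: "\<And>A B. \<lbrakk>A \<in> C; B \<in> C\<rbrakk> \<Longrightarrow> nu S (A <#> B) \<in> C"
    and star: "\<And>A. A \<in> C \<Longrightarrow> nu S (domains A) \<in> C"
  shows "right_restriction_monoid (R_nu_on C)"
proof -
  have acc: "acceptable S A" and nu: "nu S A = A" and car: "A \<subseteq> carrier S" if "A \<in> C" for A
    using that C nu_setsD acceptable_carrier by (metis subsetD)+
  have dacc: "acceptable S (domains A)" and did: "domains A \<subseteq> E" if "A \<in> C" for A
    using acc[OF that] domains_acceptable domains_idems[OF car[OF that]] by auto
  have star_nu: "nu S (domains (nu S A)) = nu S A" if "acceptable S A" "A \<subseteq> E" for A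
    using nu_domains[OF that(1)] domains_of_idems[OF that(2)] by simp
  have one_mult: "E <#> A = A" "A <#> E = A" if A: "A \<in> C" for A
  proof -
    have "\<one> \<otimes> a = a" "a \<otimes> \<one> = a" if "a \<in> A" for a using that car[OF A] by auto
    then have "A \<subseteq> E <#> A" "A \<subseteq> A <#> E" using set_multI[OF one_idem] set_multI[OF _ one_idem]
      by (metis subsetI)+
    then show "E <#> A = A" "A <#> E = A" using mult_idems_subset[OF acc[OF A] order_refl] by auto
  qed
  show ?thesis
  proof (unfold_locales, simp_all only: R_nu_on_simps)
    fix A B D assume A: "A \<in> C" and B: "B \<in> C" and D: "D \<in> C"
    show "nu S (nu S (A <#> B) <#> D) = nu S (A <#> nu S (B <#> D))"
      using acc[OF A] acc[OF B] acc[OF D] car[OF A] car[OF B] car[OF D]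
      by (simp add: nu_mult mult_acceptable set_mult_assoc_subsets)
  next
    fix A assume A: "A \<in> C"
    show "nu S (E <#> A) = A" "nu S (A <#> E) = A" using one_mult[OF A] nu[OF A] by simp_all
    show "nu S (domains (nu S (domains A))) = nu S (domains A)"
      using star_nu[OF dacc[OF A] did[OF A]] .
    show "nu S (A <#> nu S (domains A)) = A"
      using mult_domains[OF acc[OF A] acc[OF A] order_refl] nu_mult(2)[OF acc[OF A] dacc[OF A]] nu[OF A]
      by simp
  next
    fix A B assume A: "A \<in> C" and B: "B \<in> C"
    have prod: "nu S (nu S (domains A) <#> nu S (domains B)) = nu S (domains A <#> domains B)"
      using dacc[OF A] dacc[OF B] by (simp add: nu_mult nu_acceptable)
    have prod_E: "domains A <#> domains B \<subseteq> E"
      by (rule order_trans[OF mult_idems_subset(2)[OF dacc[OF B] did[OF A]] did[OF B]])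
    have prod_acc: "acceptable S (domains A <#> domains B)"
      using dacc[OF A] dacc[OF B] by (rule mult_acceptable)
    show "nu S (domains (nu S (nu S (domains A) <#> nu S (domains B)))) =
        nu S (nu S (domains A) <#> nu S (domains B))"
      unfolding prod by (rule star_nu[OF prod_acc prod_E])
    have "domains A <#> domains B = domains B <#> domains A"
    proof -
      have "(\<Union>e\<in>domains A. \<Union>f\<in>domains B. {e \<otimes> f}) = (\<Union>e\<in>domains A. \<Union>f\<in>domains B. {f \<otimes> e})"
        by (intro SUP_cong refl arg_cong[where f = "\<lambda>x. {x}"] idem_commute
            subsetD[OF did[OF A]] subsetD[OF did[OF B]])
      also have "\<dots> = (\<Union>f\<in>domains B. \<Union>e\<in>domains A. {f \<otimes> e})" by (rule SUP_commute)
      finally show ?thesis by (simp only: set_mult_def)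
    qed
    then show "nu S (nu S (domains A) <#> nu S (domains B)) = nu S (nu S (domains B) <#> nu S (domains A))"
      using dacc[OF A] dacc[OF B] by (simp add: nu_mult nu_acceptable)
    show "nu S (domains (nu S (A <#> B))) = nu S (domains (nu S (nu S (domains A) <#> B)))"
      using acc[OF A] acc[OF B] dacc[OF A] car[OF A] car[OF B]
      by (simp add: nu_mult nu_domains mult_acceptable domains_mult)
    show "nu S (nu S (domains B) <#> A) = nu S (A <#> nu S (domains (nu S (B <#> A))))"
      using acc[OF A] acc[OF B] dacc[OF B] domains_past[OF acc[OF A] car[OF B]]
      by (simp add: nu_mult nu_domains mult_acceptable domains_acceptable)
  qed (use one mult star in auto)
qed

section \<open>Finitely generated closed sets are the finite elements\<close>

definition down
  where "down F = {x \<in> carrier S. \<exists>f\<in>F. x \<preceq> f}"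

abbreviation pairwise_left_compatible
  where "pairwise_left_compatible F \<equiv> \<forall>a\<in>F. \<forall>b\<in>F. a \<otimes> b\<^sup>\<dagger> \<in> E"

lemma downI: "\<lbrakk>x \<in> carrier S; f \<in> F; x \<preceq> f\<rbrakk> \<Longrightarrow> x \<in> down F"
  and downE: "\<lbrakk>x \<in> down F; \<And>f. \<lbrakk>x \<in> carrier S; f \<in> F; x \<preceq> f\<rbrakk> \<Longrightarrow> P\<rbrakk> \<Longrightarrow> P"
  and down_carrier: "down F \<subseteq> carrier S"
  and down_mono: "F \<subseteq> G \<Longrightarrow> down F \<subseteq> down G"
  by (auto simp: down_def)

lemma subset_down: "F \<subseteq> carrier S \<Longrightarrow> F \<subseteq> down F"
  using downI below_refl by (meson subset_iff)

lemma down_subset: "\<lbrakk>acceptable S A; F \<subseteq> A\<rbrakk> \<Longrightarrow> down F \<subseteq> A"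
  by (auto elim!: downE intro: acceptable_down)

lemma down_acceptable:
  assumes "F \<subseteq> carrier S" "pairwise_left_compatible F"
  shows "acceptable S (down F)"
proof (rule acceptableI)
  show "down F \<subseteq> carrier S" by (rule down_carrier)
  show "a \<otimes> b\<^sup>\<dagger> \<in> E" if ab: "a \<in> down F" "b \<in> down F" for a b
  proof -
    obtain f g where fg: "f \<in> F" "a \<preceq> f" "a \<in> carrier S" "g \<in> F" "b \<preceq> g" "b \<in> carrier S"
      using ab by (elim downE)
    show ?thesis using fg assms by (intro left_compatible_below[of f g a b]) auto
  qed
  show "b \<in> down F" if b: "a \<in> down F" "b \<in> carrier S" "b \<preceq> a" for a b
  proof -
    obtain f where f: "f \<in> F" "a \<preceq> f" "a \<in> carrier S" using b(1) by (elim downE)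
    have "b \<preceq> f" using f assms(1) b by (intro below_trans[of b a f]) auto
    then show ?thesis using b(2) f(1) by (intro downI)
  qed
qed

lemma down_singleton_acceptable: "a \<in> carrier S \<Longrightarrow> acceptable S (down {a})"
  by (rule down_acceptable) auto

lemma nu_down_singleton:
  assumes "a \<in> carrier S"
  shows "nu S (down {a}) = down {a}"
proof (rule antisym[OF _ nu_extensive[OF down_carrier]], rule subsetI)
  fix x assume "x \<in> nu S (down {a})"
  then obtain F where F: "F \<subseteq> down {a}" "is_sup x F" by (rule nuE)
  have "x \<preceq> a" using F(1) by (intro is_sup_least[OF F(2) assms]) (auto elim!: downE)
  then show "x \<in> down {a}" using is_sup_carrier[OF F(2)] by (intro downI) auto
qed

lemma down_singleton_nu_set: "a \<in> carrier S \<Longrightarrow> down {a} \<in> \<N>"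
  by (simp add: nu_sets_iff down_singleton_acceptable nu_down_singleton)

lemma nu_down_least:
  assumes "A \<in> \<N>" "F \<subseteq> A"
  shows "nu S (down F) \<subseteq> A"
  using nu_mono[OF down_subset[OF nu_setsD(1)[OF assms(1)] assms(2)]] nu_setsD(2)[OF assms(1)] by simp

lemma generators_subset: "F \<subseteq> carrier S \<Longrightarrow> F \<subseteq> nu S (down F)"
  using order_trans[OF subset_down nu_extensive[OF down_carrier]] .

definition finitely_generated
  where "finitely_generated A \<longleftrightarrow>
    (\<exists>F. finite F \<and> F \<subseteq> carrier S \<and> pairwise_left_compatible F \<and> A = nu S (down F))"

lemma finitely_generatedI:
  "\<lbrakk>finite F; F \<subseteq> carrier S; pairwise_left_compatible F; A = nu S (down F)\<rbrakk> \<Longrightarrow> finitely_generated A"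
  unfolding finitely_generated_def by metis

lemma finitely_generatedE:
  assumes "finitely_generated A"
  obtains F where "finite F" "F \<subseteq> carrier S" "pairwise_left_compatible F" "A = nu S (down F)"
  using assms unfolding finitely_generated_def by metis

lemma finitely_generated_nu_set: "finitely_generated A \<Longrightarrow> A \<in> \<N>"
  by (auto elim!: finitely_generatedE intro!: nu_in_nu_sets down_acceptable)

lemma finitely_generated_singleton: "a \<in> carrier S \<Longrightarrow> finitely_generated (down {a})"
  by (intro finitely_generatedI[of "{a}"]) (simp_all add: nu_down_singleton)

text \<open>A closed set is the join of the principal ideals it contains; finiteness selects finitely many
  of these, and they generate. Conversely, if a finitely generated set lies below the join
  \<open>\<nu>(\<Union>X)\<close>, each generator is a finite join of members of \<open>\<Union>X\<close>, so that all generators together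
  involve only finitely many members of \<open>X\<close>.\<close>

lemma finite_elements_iff: "A \<in> finite_elements (R_nu S) \<longleftrightarrow> finitely_generated A"
proof
  assume "A \<in> finite_elements (R_nu S)"
  then have A: "A \<in> \<N>" and fin: "\<And>X J. \<lbrakk>X \<subseteq> \<N>; left_compatible_set (R_nu_on \<N>) X; is_join (R_nu_on \<N>) J X;
      nat_le (R_nu_on \<N>) A J\<rbrakk> \<Longrightarrow> \<exists>G K. finite G \<and> G \<subseteq> X \<and> is_join (R_nu_on \<N>) K G \<and> nat_le (R_nu_on \<N>) A K"
    by (simp_all add: finite_elements_def) metis
  note accA = nu_setsD(1)[OF A] note AC = subsetD[OF acceptable_carrier[OF accA]]
  \<comment> \<open>the join that finiteness is applied to: \<open>A\<close> as the union of its principal ideals\<close>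
  let ?X = "(\<lambda>a. down {a}) ` A"
  have XN: "?X \<subseteq> \<N>" using AC by (auto intro!: down_singleton_nu_set)
  have XA: "D \<subseteq> A" if "D \<in> ?X" for D using that down_subset[OF accA] by auto
  have UX: "\<Union>?X = A"
  proof
    show "\<Union>?X \<subseteq> A" using XA by (rule Union_least)
    show "A \<subseteq> \<Union>?X" using subset_down[of "{_}"] AC by auto
  qed
  have "left_compatible (R_nu_on \<N>) D D'" if D: "D \<in> ?X" "D' \<in> ?X" for D D'
    using left_compatible_R_nu_on_iff[OF subsetD[OF XN D(1)] subsetD[OF XN D(2)]]
      acceptable_left_compatible[OF accA] XA[OF D(1)] XA[OF D(2)] by (meson subsetD)
  then have lc: "left_compatible_set (R_nu_on \<N>) ?X" unfolding left_compatible_set_def by simp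
  have "is_join (R_nu_on \<N>) A ?X"
    using nu_Union_is_join[OF order_refl XN] A unfolding UX nu_setsD(2)[OF A] .
  moreover have "nat_le (R_nu_on \<N>) A A" by (simp only: nat_le_R_nu_on_iff[OF A A])
  ultimately obtain G K where G: "finite G" "G \<subseteq> ?X" "is_join (R_nu_on \<N>) K G" "nat_le (R_nu_on \<N>) A K"
    using fin[OF XN lc] by metis
  obtain F where F: "F \<subseteq> A" "finite F" "G = (\<lambda>a. down {a}) ` F"
    using finite_subset_image[OF G(1,2)] by auto
  have FC: "F \<subseteq> carrier S" using F(1) AC by auto
  have Flc: "pairwise_left_compatible F" using F(1) acceptable_left_compatible[OF accA] by (meson subsetD)
  have J: "nu S (down F) \<in> \<N>" by (intro nu_in_nu_sets down_acceptable FC Flc)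
  have "\<Union>G = down F" unfolding F(3) by (auto simp: down_def)
  then have "is_join (R_nu_on \<N>) (nu S (down F)) G"
    using nu_Union_is_join[OF order_refl, of G] G(2) XN J by (metis order_trans)
  then have K: "K = nu S (down F)" using is_join_R_nu_on_unique[OF order_refl G(3)] by simp
  have "A \<subseteq> nu S (down F)" using G(4) by (simp only: K nat_le_R_nu_on_iff[OF A J])
  then have "A = nu S (down F)" using nu_down_least[OF A F(1)] by (rule subset_antisym)
  then show "finitely_generated A" by (rule finitely_generatedI[OF F(2) FC Flc])
next
  assume "finitely_generated A"
  then have A: "A \<in> \<N>" by (rule finitely_generated_nu_set)
  obtain F where F: "finite F" "F \<subseteq> carrier S" "A = nu S (down F)"
    using \<open>finitely_generated A\<close> by (rule finitely_generatedE)
  have "\<exists>G K. finite G \<and> G \<subseteq> X \<and> is_join (R_nu_on \<N>) K G \<and> nat_le (R_nu_on \<N>) A K"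
    if X: "X \<subseteq> \<N>" "left_compatible_set (R_nu_on \<N>) X" and J: "is_join (R_nu_on \<N>) J X" "nat_le (R_nu_on \<N>) A J"
    for X J
  proof -
    have UX: "acceptable S (\<Union>X)" using X by (rule left_compatible_Union_acceptable)
    have J_eq: "J = nu S (\<Union>X)"
      using is_join_R_nu_on_unique[OF order_refl J(1) nu_Union_is_join[OF order_refl X(1) nu_in_nu_sets[OF UX]]] .
    have "A \<subseteq> nu S (\<Union>X)"
      using J(2) by (simp only: J_eq nat_le_R_nu_on_iff[OF A nu_in_nu_sets[OF UX]])
    then have FX: "F \<subseteq> nu S (\<Union>X)" using generators_subset[OF F(2)] unfolding F(3) by (rule order_trans[rotated])
    have "\<exists>G. finite G \<and> G \<subseteq> X \<and> f \<in> nu S (\<Union>G)" if f: "f \<in> F" for f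
    proof -
      obtain H where H: "finite H" "H \<subseteq> \<Union>X" "pairwise_compatible H" "is_sup f H"
        using subsetD[OF FX f] by (rule nuE)
      obtain G where "finite G" "G \<subseteq> X" "H \<subseteq> \<Union>G" using finite_subset_Union[OF H(1,2)] by metis
      then show ?thesis using nuI[OF H(1) _ H(3,4)] by metis
    qed
    then obtain \<Gamma> where \<Gamma>: "\<And>f. f \<in> F \<Longrightarrow> finite (\<Gamma> f)" "\<And>f. f \<in> F \<Longrightarrow> \<Gamma> f \<subseteq> X"
      "\<And>f. f \<in> F \<Longrightarrow> f \<in> nu S (\<Union>(\<Gamma> f))" by metis
    let ?G = "\<Union>(\<Gamma> ` F)"
    have G: "finite ?G" "?G \<subseteq> X" using F(1) \<Gamma> by auto
    have UG: "acceptable S (\<Union>?G)"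
    proof (rule left_compatible_Union_acceptable[OF order_trans[OF G(2) X(1)]])
      show "left_compatible_set (R_nu_on \<N>) ?G"
        using X(2) G(2) unfolding left_compatible_set_def by (meson subsetD)
    qed
    have "F \<subseteq> nu S (\<Union>?G)"
    proof
      fix f assume f: "f \<in> F"
      have "\<Union>(\<Gamma> f) \<subseteq> \<Union>?G" using f by (intro Union_mono UN_upper)
      then show "f \<in> nu S (\<Union>?G)" using \<Gamma>(3)[OF f] nu_mono by (metis subsetD)
    qed
    then have "A \<subseteq> nu S (\<Union>?G)" unfolding F(3) by (rule nu_down_least[OF nu_in_nu_sets[OF UG]])
    then have "nat_le (R_nu_on \<N>) A (nu S (\<Union>?G))" by (simp only: nat_le_R_nu_on_iff[OF A nu_in_nu_sets[OF UG]])
    moreover have "is_join (R_nu_on \<N>) (nu S (\<Union>?G)) ?G"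
      using nu_Union_is_join[OF order_refl order_trans[OF G(2) X(1)] nu_in_nu_sets[OF UG]] .
    ultimately show ?thesis using G by metis
  qed
  then show "A \<in> finite_elements (R_nu S)"
    using A by (simp add: finite_elements_def) metis
qed

end

section \<open>Transfer of Boolean algebras along order isomorphisms\<close>

text \<open>Joins, meets and bounds are selected by Hilbert choice in each of the two orders; they
  correspond to each other by uniqueness of least and greatest elements.\<close>

lemma boolean_algebra_order_transfer:
  fixes L :: "'a gorder" and L' :: "'b gorder"
  assumes L: "boolean_algebra_order L" and bij: "bij_betw f (carrier L) (carrier L')"
    and le: "\<And>x y. \<lbrakk>x \<in> carrier L; y \<in> carrier L\<rbrakk> \<Longrightarrow> f x \<sqsubseteq>\<^bsub>L'\<^esub> f y \<longleftrightarrow> x \<sqsubseteq>\<^bsub>L\<^esub> y"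
    and eq: "eq L' = (=)"
  shows "boolean_algebra_order L' \<and> \<bottom>\<^bsub>L'\<^esub> = f \<bottom>\<^bsub>L\<^esub>"
proof -
  interpret L: boolean_algebra_order L by (rule L)
  have car: "carrier L' = f ` carrier L" using bij by (simp add: bij_betw_def)
  have ex: "\<And>P. (\<forall>y\<in>carrier L'. P y) \<longleftrightarrow> (\<forall>x\<in>carrier L. P (f x))" by (simp add: car)
  have inj: "\<lbrakk>x \<in> carrier L; y \<in> carrier L; f x = f y\<rbrakk> \<Longrightarrow> x = y" for x y
    using bij by (auto simp: bij_betw_def inj_on_def)
  have least_iff: "least L' (f x) (f ` A) \<longleftrightarrow> least L x A" if "x \<in> carrier L" "A \<subseteq> carrier L" for x A
  proof -
    have "f x \<in> f ` A \<longleftrightarrow> x \<in> A" using inj that by blast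
    then show ?thesis using that le by (auto simp: least_def car subset_iff)
  qed
  have greatest_iff: "greatest L' (f x) (f ` A) \<longleftrightarrow> greatest L x A" if "x \<in> carrier L" "A \<subseteq> carrier L" for x A
  proof -
    have "f x \<in> f ` A \<longleftrightarrow> x \<in> A" using inj that by blast
    then show ?thesis using that le by (auto simp: greatest_def car subset_iff)
  qed
  have Upper: "Upper L' {f x, f y} = f ` Upper L {x, y}" and Lower: "Lower L' {f x, f y} = f ` Lower L {x, y}"
    if "x \<in> carrier L" "y \<in> carrier L" for x y
    using that le by (auto simp: Upper_def Lower_def car)
  have sup: "least L' (f (x \<squnion>\<^bsub>L\<^esub> y)) (Upper L' {f x, f y})" if "x \<in> carrier L" "y \<in> carrier L" for x y
    unfolding Upper[OF that] using that L.sup_of_two_least[OF that] L.join_closed[OF that]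
    by (simp add: least_iff join_def)
  have inf: "greatest L' (f (x \<sqinter>\<^bsub>L\<^esub> y)) (Lower L' {f x, f y})" if "x \<in> carrier L" "y \<in> carrier L" for x y
    unfolding Lower[OF that] using that L.inf_of_two_greatest[OF that] L.meet_closed[OF that]
    by (simp add: greatest_iff meet_def)
  have bot: "least L' (f \<bottom>\<^bsub>L\<^esub>) (carrier L')"
    unfolding car using L.bottom_least by (simp add: least_iff)
  have top: "greatest L' (f \<top>\<^bsub>L\<^esub>) (carrier L')"
    unfolding car using L.top_greatest by (simp add: greatest_iff)
  interpret L': bounded_lattice L'
  proof
    show "x \<sqsubseteq>\<^bsub>L'\<^esub> z" if xyz: "x \<sqsubseteq>\<^bsub>L'\<^esub> y" "y \<sqsubseteq>\<^bsub>L'\<^esub> z" "x \<in> carrier L'" "y \<in> carrier L'" "z \<in> carrier L'" for x y z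
    proof -
      obtain u v w where "u \<in> carrier L" "v \<in> carrier L" "w \<in> carrier L" "x = f u" "y = f v" "z = f w"
        using xyz car by auto
      then show ?thesis using xyz(1,2) le L.le_trans by metis
    qed
    show "x .=\<^bsub>L'\<^esub> y" if xy: "x \<sqsubseteq>\<^bsub>L'\<^esub> y" "y \<sqsubseteq>\<^bsub>L'\<^esub> x" "x \<in> carrier L'" "y \<in> carrier L'" for x y
    proof -
      obtain u v where "u \<in> carrier L" "v \<in> carrier L" "x = f u" "y = f v" using xy car by auto
      then show ?thesis using xy(1,2) le L.le_antisym eq by metis
    qed
    show "\<exists>s. least L' s (Upper L' {x, y})" if "x \<in> carrier L'" "y \<in> carrier L'" for x y
      using that sup unfolding car by blast
    show "\<exists>s. greatest L' s (Lower L' {x, y})" if "x \<in> carrier L'" "y \<in> carrier L'" for x y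
      using that inf unfolding car by blast
  qed (use eq le bot top in \<open>auto simp: car\<close>)
  have join': "f x \<squnion>\<^bsub>L'\<^esub> f y = f (x \<squnion>\<^bsub>L\<^esub> y)" if "x \<in> carrier L" "y \<in> carrier L" for x y
  proof -
    have "f x \<in> carrier L'" "f y \<in> carrier L'" using that car by auto
    then show ?thesis
      using L'.least_unique[OF _ sup[OF that]] L'.sup_of_two_least by (simp add: join_def)
  qed
  have meet': "f x \<sqinter>\<^bsub>L'\<^esub> f y = f (x \<sqinter>\<^bsub>L\<^esub> y)" if "x \<in> carrier L" "y \<in> carrier L" for x y
  proof -
    have "f x \<in> carrier L'" "f y \<in> carrier L'" using that car by auto
    then show ?thesis
      using L'.greatest_unique[OF _ inf[OF that]] L'.inf_of_two_greatest by (simp add: meet_def)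
  qed
  have bot': "\<bottom>\<^bsub>L'\<^esub> = f \<bottom>\<^bsub>L\<^esub>" by (rule L'.least_unique[OF L'.bottom_least bot])
  have top': "\<top>\<^bsub>L'\<^esub> = f \<top>\<^bsub>L\<^esub>" by (rule L'.greatest_unique[OF L'.top_greatest top])
  have "boolean_algebra_order L'"
  proof
    show "x \<sqinter>\<^bsub>L'\<^esub> (y \<squnion>\<^bsub>L'\<^esub> z) = (x \<sqinter>\<^bsub>L'\<^esub> y) \<squnion>\<^bsub>L'\<^esub> (x \<sqinter>\<^bsub>L'\<^esub> z)"
      if xyz: "x \<in> carrier L'" "y \<in> carrier L'" "z \<in> carrier L'" for x y z
    proof -
      obtain u v w where "u \<in> carrier L" "v \<in> carrier L" "w \<in> carrier L" "x = f u" "y = f v" "z = f w"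
        using xyz car by auto
      then show ?thesis using L.meet_join_distrib by (simp add: join' meet')
    qed
    show "\<exists>y\<in>carrier L'. x \<sqinter>\<^bsub>L'\<^esub> y = \<bottom>\<^bsub>L'\<^esub> \<and> x \<squnion>\<^bsub>L'\<^esub> y = \<top>\<^bsub>L'\<^esub>" if x: "x \<in> carrier L'" for x
    proof -
      obtain u where u: "u \<in> carrier L" "x = f u" using x car by auto
      obtain v where "v \<in> carrier L" "u \<sqinter>\<^bsub>L\<^esub> v = \<bottom>\<^bsub>L\<^esub>" "u \<squnion>\<^bsub>L\<^esub> v = \<top>\<^bsub>L\<^esub>"
        using L.complement_exists[OF u(1)] by auto
      then show ?thesis using u by (intro bexI[of _ "f v"]) (auto simp: join' meet' bot' top' car)
    qed
  qed
  then show ?thesis using bot' by simp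
qed

section \<open>The companion of a Boolean inverse monoid\<close>

context boolean_inverse_monoid
begin

abbreviation generated (\<open>\<G>\<close>)
  where "\<G> \<equiv> {A. finitely_generated A}"

lemma Etale_eq_R_nu_on: "Etale S = R_nu_on \<G>"
proof -
  have "finite_elements (R_nu S) = \<G>" by (simp add: set_eq_iff finite_elements_iff)
  then show ?thesis by (simp add: Etale_def)
qed

lemma generated_subset: "\<G> \<subseteq> \<N>"
  by (rule subsetI) (simp add: finitely_generated_nu_set)

lemma down_one: "down {\<one>} = E"
  by (auto simp: down_def below_one_iff)

text \<open>The next two lemmas show that products and domains of generators generate the product and the
  star, which is why the finitely generated sets are closed under the operations.\<close>

lemma down_mult_down:
  assumes F: "F \<subseteq> carrier S" "pairwise_left_compatible F" and G: "G \<subseteq> carrier S" "pairwise_left_compatible G"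
  shows "down F <#> down G = down (F <#> G)"
proof
  show "down F <#> down G \<subseteq> down (F <#> G)"
  proof
    fix x assume "x \<in> down F <#> down G"
    then obtain a b where x: "a \<in> down F" "b \<in> down G" "x = a \<otimes> b" by (elim set_multE)
    obtain f g where fg: "a \<in> carrier S" "f \<in> F" "a \<preceq> f" "b \<in> carrier S" "g \<in> G" "b \<preceq> g"
      using x by (elim downE)
    then have "a \<otimes> b \<preceq> f \<otimes> g" using F(1) G(1) by (intro below_mult) auto
    then show "x \<in> down (F <#> G)" using fg by (auto simp: x intro: downI set_multI)
  qed
  show "down (F <#> G) \<subseteq> down F <#> down G"
    using F G by (intro down_subset mult_acceptable down_acceptable mono_set_mult subset_down)
qed

lemma domains_down:
  assumes F: "F \<subseteq> carrier S" "pairwise_left_compatible F"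
  shows "domains (down F) = down (domains F)"
proof
  show "domains (down F) \<subseteq> down (domains F)"
  proof (intro image_subsetI)
    fix x assume "x \<in> down F"
    then obtain f where f: "x \<in> carrier S" "f \<in> F" "x \<preceq> f" by (rule downE)
    then have "x\<^sup>\<star> \<preceq> f\<^sup>\<star>" using F(1) by (intro below_mult below_inverse) auto
    then show "x\<^sup>\<star> \<in> down (domains F)" by (rule downI[OF domain_closed[OF f(1)] imageI[OF f(2)]])
  qed
  show "down (domains F) \<subseteq> domains (down F)"
    using F by (intro down_subset domains_acceptable down_acceptable image_mono subset_down)
qed

lemma generated_mult:
  assumes "A \<in> \<G>" "B \<in> \<G>"
  shows "nu S (A <#> B) \<in> \<G>"
proof -
  obtain F where F: "finite F" "F \<subseteq> carrier S" "pairwise_left_compatible F" "A = nu S (down F)"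
    using assms(1) by (auto elim: finitely_generatedE)
  obtain G where G: "finite G" "G \<subseteq> carrier S" "pairwise_left_compatible G" "B = nu S (down G)"
    using assms(2) by (auto elim: finitely_generatedE)
  have acc: "acceptable S (down F)" "acceptable S (down G)" using F G by (auto intro: down_acceptable)
  have FG: "F <#> G \<subseteq> down F <#> down G" using F G by (intro mono_set_mult subset_down)
  have accFG: "acceptable S (down F <#> down G)" using acc by (rule mult_acceptable)
  have "nu S (A <#> B) = nu S (down F <#> down G)"
    unfolding F(4) G(4) using acc by (simp add: nu_mult nu_acceptable)
  also have "\<dots> = nu S (down (F <#> G))" by (simp only: down_mult_down[OF F(2,3) G(2,3)])
  finally have "nu S (A <#> B) = nu S (down (F <#> G))" .
  moreover have "finite (F <#> G)" using F(1) G(1) by (simp add: set_mult_def)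
  moreover have "F <#> G \<subseteq> carrier S" using F(2) G(2) by (rule set_mult_closed)
  moreover have "pairwise_left_compatible (F <#> G)"
    using acceptable_left_compatible[OF accFG] FG by (meson subsetD)
  ultimately have "finitely_generated (nu S (A <#> B))" by (intro finitely_generatedI)
  then show ?thesis by simp
qed

lemma generated_star:
  assumes "A \<in> \<G>"
  shows "nu S (domains A) \<in> \<G>"
proof -
  obtain F where F: "finite F" "F \<subseteq> carrier S" "pairwise_left_compatible F" "A = nu S (down F)"
    using assms by (auto elim: finitely_generatedE)
  have "nu S (domains A) = nu S (down (domains F))"
    unfolding F(4) by (simp only: nu_domains[OF down_acceptable[OF F(2,3)]] domains_down[OF F(2,3)])
  moreover have "a \<otimes> b\<^sup>\<dagger> \<in> E" if "a \<in> domains F" "b \<in> domains F" for a b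
  proof -
    have "a \<in> E" "b \<in> E" using that[THEN subsetD[OF domains_idems[OF F(2)]]] .
    then show ?thesis by simp
  qed
  moreover have "domains F \<subseteq> carrier S" using F(2) by auto
  ultimately have "finitely_generated (nu S (domains A))"
    using F(1) by (intro finitely_generatedI[of "domains F"]) simp_all
  then show ?thesis by simp
qed

lemma generated_Un:
  assumes "A \<in> \<G>" "B \<in> \<G>" and AB: "acceptable S (A \<union> B)"
  shows "nu S (A \<union> B) \<in> \<G>"
proof -
  obtain F where F: "finite F" "F \<subseteq> carrier S" "A = nu S (down F)"
    using assms(1) by (auto elim: finitely_generatedE)
  obtain G where G: "finite G" "G \<subseteq> carrier S" "B = nu S (down G)"
    using assms(2) by (auto elim: finitely_generatedE)
  have sub: "F \<union> G \<subseteq> A \<union> B" unfolding F(3) G(3) using F(2) G(2) by (intro Un_mono generators_subset)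
  have "A \<union> B \<subseteq> nu S (down (F \<union> G))"
    unfolding F(3) G(3) by (intro Un_least nu_mono down_mono) auto
  then have "nu S (A \<union> B) \<subseteq> nu S (down (F \<union> G))" by (rule nu_nu_un[OF down_carrier])
  moreover have "nu S (down (F \<union> G)) \<subseteq> nu S (A \<union> B)" by (rule nu_mono[OF down_subset[OF AB sub]])
  ultimately have eq: "nu S (A \<union> B) = nu S (down (F \<union> G))" by (rule subset_antisym)
  have "pairwise_left_compatible (F \<union> G)" using acceptable_left_compatible[OF AB] sub by (meson subsetD)
  then have "finitely_generated (nu S (A \<union> B))"
    using F G eq by (intro finitely_generatedI[of "F \<union> G"]) simp_all
  then show ?thesis by simp
qed

lemma generated_right_restriction_monoid: "right_restriction_monoid (R_nu_on \<G>)"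
proof (rule R_nu_on_right_restriction_monoid)
  have "finitely_generated (down {\<one>})" by (rule finitely_generated_singleton) simp
  then show "E \<in> \<G>" by (simp add: down_one)
qed (use generated_subset generated_mult generated_star in simp_all)

lemma left_compatible_Un_acceptable:
  assumes A: "A \<in> \<N>" and B: "B \<in> \<N>" and lc: "left_compatible (R_nu_on C) A B"
  shows "acceptable S (A \<union> B)"
proof -
  have self: "left_compatible (R_nu_on C) D D" for D by (simp add: left_compatible_def)
  have "left_compatible (R_nu_on C) B A" using lc by (simp add: left_compatible_def)
  then have "left_compatible_set (R_nu_on C) {A, B}" using lc self by (simp add: left_compatible_set_def)
  then have "acceptable S (\<Union>{A, B})" using A B by (intro left_compatible_Union_acceptable) auto
  then show ?thesis by simp
qed

lemma nu_Un_is_join: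
  assumes "A \<in> \<G>" "B \<in> \<G>" "acceptable S (A \<union> B)"
  shows "is_join (R_nu_on \<G>) (nu S (A \<union> B)) {A, B}"
proof -
  have "is_join (R_nu_on \<G>) (nu S (\<Union>{A, B})) {A, B}"
    using generated_Un[OF assms] assms(1,2) by (intro nu_Union_is_join[OF generated_subset]) auto
  then show ?thesis by simp
qed

text \<open>Joins distribute because \<open>(A \<union> B) D = A D \<union> B D\<close> already holds for products of sets.\<close>

lemma generated_join_mult:
  assumes A: "A \<in> \<G>" and B: "B \<in> \<G>" and D: "D \<in> \<G>"
    and lc: "left_compatible (R_nu_on \<G>) A B" and J: "is_join (R_nu_on \<G>) J {A, B}"
  shows "is_join (R_nu_on \<G>) (nu S (J <#> D)) {nu S (A <#> D), nu S (B <#> D)}"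
proof -
  note N = subsetD[OF generated_subset]
  have AB: "acceptable S (A \<union> B)" using left_compatible_Un_acceptable[OF N[OF A] N[OF B] lc] .
  have accD: "acceptable S D" using N[OF D] by (rule nu_setsD)
  have J_eq: "J = nu S (A \<union> B)" using is_join_R_nu_on_unique[OF generated_subset J nu_Un_is_join[OF A B AB]] .
  have acc: "acceptable S ((A \<union> B) <#> D)" using AB accD by (rule mult_acceptable)
  have Un: "(A \<union> B) <#> D = (A <#> D) \<union> (B <#> D)" unfolding set_mult_def by (rule UN_Un)
  have AD: "A <#> D \<subseteq> carrier S" "B <#> D \<subseteq> carrier S" using acceptable_carrier[OF acc] unfolding Un by auto
  let ?U = "nu S (A <#> D) \<union> nu S (B <#> D)"
  have sub1: "(A <#> D) \<union> (B <#> D) \<subseteq> ?U" using AD by (intro Un_mono nu_extensive)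
  have sub2: "?U \<subseteq> nu S ((A <#> D) \<union> (B <#> D))" by (intro Un_least nu_mono) auto
  have "nu S (J <#> D) = nu S ((A <#> D) \<union> (B <#> D))" unfolding J_eq using AB accD by (simp add: nu_mult Un)
  also have "\<dots> = nu S ?U"
    using nu_mono[OF sub1] nu_nu_un[OF _ sub2] AD by (intro subset_antisym) auto
  finally have eq: "nu S (J <#> D) = nu S (\<Union>{nu S (A <#> D), nu S (B <#> D)})" by simp
  have "J \<in> \<G>" using generated_Un[OF A B AB] by (simp only: J_eq)
  then have "nu S (J <#> D) \<in> \<G>" using D by (rule generated_mult)
  then show ?thesis unfolding eq
    using generated_mult[OF A D] generated_mult[OF B D] by (intro nu_Union_is_join[OF generated_subset]) auto
qed

section \<open>Principal ideals\<close>

lemma down_singleton_subset_iff: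
  assumes "a \<in> carrier S" "b \<in> carrier S"
  shows "down {a} \<subseteq> down {b} \<longleftrightarrow> a \<preceq> b"
proof
  assume "down {a} \<subseteq> down {b}"
  moreover have "a \<in> down {a}" using assms(1) by (intro downI) auto
  ultimately have "a \<in> down {b}" by (rule subsetD)
  then show "a \<preceq> b" by (auto elim!: downE)
next
  assume ab: "a \<preceq> b"
  show "down {a} \<subseteq> down {b}"
  proof
    fix x assume "x \<in> down {a}"
    then have x: "x \<in> carrier S" "x \<preceq> a" by (auto elim!: downE)
    then have "x \<preceq> b" using below_trans[OF _ ab] assms by simp
    then show "x \<in> down {b}" using x(1) by (intro downI) auto
  qed
qed

lemma down_singleton_inj: "inj_on (\<lambda>a. down {a}) (carrier S)"
  by (intro inj_onI below_antisym) (auto simp flip: down_singleton_subset_iff)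

lemma down_singleton_mult:
  assumes "a \<in> carrier S" "b \<in> carrier S"
  shows "nu S (down {a} <#> down {b}) = down {a \<otimes> b}"
proof -
  have "down {a} <#> down {b} = down ({a} <#> {b})" using assms by (intro down_mult_down) simp_all
  also have "{a} <#> {b} = {a \<otimes> b}" by (simp add: set_mult_def)
  finally show ?thesis using assms by (simp add: nu_down_singleton)
qed

lemma down_singleton_star:
  assumes "a \<in> carrier S"
  shows "nu S (domains (down {a})) = down {a\<^sup>\<star>}"
  using assms domains_down[of "{a}"] by (simp add: nu_down_singleton)

section \<open>Projections\<close>

text \<open>The generators have a join in \<open>S\<close>, and a closed set contains it. This identifies both the
  projections, since idempotents are always compatible, and the partial units.\<close>

lemma compatible_generated_principal:
  assumes "A \<in> \<G>" "pairwise_compatible A"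
  obtains a where "a \<in> A" "A = down {a}"
proof -
  obtain F where F: "finite F" "F \<subseteq> carrier S" "A = nu S (down F)"
    using assms(1) by (auto elim: finitely_generatedE)
  have A: "A \<in> \<N>" using generated_subset assms(1) by (rule subsetD)
  have FA: "F \<subseteq> A" unfolding F(3) by (rule generators_subset[OF F(2)])
  then have comp: "pairwise_compatible F" using assms(2) by (meson subsetD)
  obtain a where a: "is_sup a F" using finite_join_exists[OF F(1,2) comp] .
  have aC: "a \<in> carrier S" using a by (rule is_sup_carrier)
  have "a \<in> nu S A" by (rule nuI[OF F(1) FA comp a])
  then have aA: "a \<in> A" by (simp only: nu_setsD(2)[OF A])
  have "F \<subseteq> down {a}" using is_sup_upper[OF a] F(2) by (intro subsetI downI) auto
  then have "A \<subseteq> down {a}" unfolding F(3) by (rule nu_down_least[OF down_singleton_nu_set[OF aC]])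
  moreover have "down {a} \<subseteq> A" using aA by (intro down_subset[OF nu_setsD(1)[OF A]]) simp
  ultimately show thesis using that aA by (metis subset_antisym)
qed

lemma Proj_generated: "Proj (R_nu_on \<G>) = (\<lambda>e. down {e}) ` E"
proof
  show "Proj (R_nu_on \<G>) \<subseteq> (\<lambda>e. down {e}) ` E"
  proof
    fix A assume "A \<in> Proj (R_nu_on \<G>)"
    then have A: "A \<in> \<G>" and eq: "nu S (domains A) = A" by (simp_all add: Proj_def)
    have "A \<subseteq> carrier S" using nu_carrier[of "domains A"] by (simp only: eq)
    then have AE: "A \<subseteq> E" using nu_idems[OF domains_idems, of A] by (simp only: eq)
    then have "pairwise_compatible A" using compatible_idem by (meson subsetD)
    then obtain a where "a \<in> A" "A = down {a}" using compatible_generated_principal[OF A] by metis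
    then show "A \<in> (\<lambda>e. down {e}) ` E" using AE by (meson imageI image_iff subsetD)
  qed
  show "(\<lambda>e. down {e}) ` E \<subseteq> Proj (R_nu_on \<G>)"
  proof (intro image_subsetI)
    fix e assume e: "e \<in> E"
    then have "e\<^sup>\<star> = e" by simp
    then show "down {e} \<in> Proj (R_nu_on \<G>)"
      using e down_singleton_star[of e] finitely_generated_singleton[of e] by (simp add: Proj_def)
  qed
qed

lemma Proj_generated_boolean:
  "boolean_algebra_order (nat_order_on (R_nu_on \<G>) (Proj (R_nu_on \<G>)))"
  "\<bottom>\<^bsub>nat_order_on (R_nu_on \<G>) (Proj (R_nu_on \<G>))\<^esub> = down {zero}"
proof -
  let ?L = "nat_order_on (inv_star S) E" and ?P = "nat_order_on (R_nu_on \<G>) (Proj (R_nu_on \<G>))"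
  interpret L: boolean_algebra_order ?L by (rule idempotents_boolean)
  have car: "carrier ?L = E" "carrier ?P = (\<lambda>e. down {e}) ` E"
    by (simp_all add: nat_order_on_def Proj_generated)
  have le: "le ?P (down {e}) (down {f}) \<longleftrightarrow> le ?L e f" if "e \<in> carrier ?L" "f \<in> carrier ?L" for e f
  proof -
    have "e \<in> carrier S" "f \<in> carrier S" using that by (auto simp: car)
    then show ?thesis unfolding nat_order_on_def
      by (simp only: gorder.simps nat_le_R_nu_on_iff down_singleton_nu_set down_singleton_subset_iff)
  qed
  have "inj_on (\<lambda>e. down {e}) E" using down_singleton_inj by (rule inj_on_subset) (auto simp: car)
  then have "bij_betw (\<lambda>e. down {e}) (carrier ?L) (carrier ?P)" unfolding car by (rule inj_on_imp_bij_betw)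
  from boolean_algebra_order_transfer[OF idempotents_boolean this le]
  have *: "boolean_algebra_order ?P" "\<bottom>\<^bsub>?P\<^esub> = down {\<bottom>\<^bsub>?L\<^esub>}" by (simp_all add: nat_order_on_def)
  show "boolean_algebra_order ?P" by (rule *(1))
  have "zero = \<bottom>\<^bsub>?L\<^esub>"
    by (rule L.bottom_eq) (auto simp: nat_order_on_def zero_idem intro: zero_below)
  then show "\<bottom>\<^bsub>?P\<^esub> = down {zero}" using *(2) by simp
qed

lemma down_zero: "down {zero} = {zero}"
proof
  show "down {zero} \<subseteq> {zero}"
    using below_antisym zero_below zero(1) by (auto elim!: downE)
  show "{zero} \<subseteq> down {zero}" using zero(1) by (intro subset_down) simp
qed

lemma down_zero_is_zero: "is_zero (R_nu_on \<G>) (down {zero})"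
proof -
  have "down {zero} <#> A = down {zero}" "A <#> down {zero} = down {zero}" if A: "A \<in> \<G>" for A
  proof -
    have N: "A \<in> \<N>" using generated_subset A by (rule subsetD)
    have C: "a \<in> carrier S" if "a \<in> A" for a
      using acceptable_carrier[OF nu_setsD(1)[OF N]] that by (rule subsetD)
    have "zero \<in> A" using zero_in_nu[of A] by (simp only: nu_setsD(2)[OF N])
    then show "down {zero} <#> A = down {zero}" "A <#> down {zero} = down {zero}"
      using C by (auto simp: down_zero set_mult_def zero)
  qed
  then show ?thesis
    using finitely_generated_singleton[OF zero(1)] by (simp add: is_zero_def nu_down_singleton zero(1))
qed

lemma generated_boolean: "boolean_right_restriction_monoid (R_nu_on \<G>)"
proof (intro boolean_right_restriction_monoid.intro boolean_right_restriction_monoid_axioms.intro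
    generated_right_restriction_monoid)
  fix A B assume A: "A \<in> carrier (R_nu_on \<G>)" and B: "B \<in> carrier (R_nu_on \<G>)" and lc: "left_compatible (R_nu_on \<G>) A B"
  have G: "A \<in> \<G>" "B \<in> \<G>" using A B by simp_all
  note N = subsetD[OF generated_subset]
  show "\<exists>J. is_join (R_nu_on \<G>) J {A, B}"
    using nu_Un_is_join[OF G left_compatible_Un_acceptable[OF N[OF G(1)] N[OF G(2)] lc]] by (rule exI)
  fix D J assume D: "D \<in> carrier (R_nu_on \<G>)" and J: "is_join (R_nu_on \<G>) J {A, B}"
  have "D \<in> \<G>" using D by simp
  from generated_join_mult[OF G this lc J]
  show "is_join (R_nu_on \<G>) (J \<otimes>\<^bsub>R_nu_on \<G>\<^esub> D) {A \<otimes>\<^bsub>R_nu_on \<G>\<^esub> D, B \<otimes>\<^bsub>R_nu_on \<G>\<^esub> D}" by (simp only: R_nu_on_simps)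
next
  show "boolean_algebra_order (nat_order_on (R_nu_on \<G>) (Proj (R_nu_on \<G>)))" by (rule Proj_generated_boolean)
  show "is_zero (R_nu_on \<G>) (\<bottom>\<^bsub>nat_order_on (R_nu_on \<G>) (Proj (R_nu_on \<G>))\<^esub>)"
    by (simp only: Proj_generated_boolean(2) down_zero_is_zero)
qed

section \<open>Partial units\<close>

text \<open>Let \<open>Q\<close> be an inverse of the partial unit \<open>P\<close>. Left compatibility makes \<open>a \<otimes> b\<^sup>\<dagger>\<close> idempotent
  for \<open>a, b \<in> P\<close>; the point is the other half, \<open>a\<^sup>\<dagger> \<otimes> b\<close>. It suffices that \<open>a\<^sup>\<dagger> \<in> Q\<close>, for
  then \<open>a\<^sup>\<dagger> \<otimes> b\<close> lies in \<open>\<nu>(Q P)\<close>, which consists of idempotents. Now \<open>a\<^sup>\<star> \<in> \<nu>(Q P)\<close> is a finite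
  join of elements \<open>q \<otimes> p\<close>, so \<open>a\<^sup>\<dagger> = a\<^sup>\<star> \<otimes> a\<^sup>\<dagger>\<close> is the join of the elements \<open>q \<otimes> (p \<otimes> a\<^sup>\<dagger>)\<close>,
  and \<open>p \<otimes> a\<^sup>\<dagger>\<close> is idempotent.\<close>

lemma partial_unit_compatible:
  assumes P: "P \<in> \<N>" and Q: "Q \<in> \<N>" and QP: "nu S (Q <#> P) = nu S (domains P)"
  shows "pairwise_compatible P"
proof (intro ballI)
  fix a b assume a: "a \<in> P" and b: "b \<in> P"
  note accP = nu_setsD(1)[OF P] and accQ = nu_setsD(1)[OF Q]
  note PC = subsetD[OF acceptable_carrier[OF accP]] and QC = subsetD[OF acceptable_carrier[OF accQ]]
  have domC: "domains P \<subseteq> carrier S" using PC by auto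
  have QPC: "Q <#> P \<subseteq> carrier S" using acceptable_carrier[OF mult_acceptable[OF accQ accP]] .
  have "a\<^sup>\<star> \<in> nu S (Q <#> P)" unfolding QP by (rule subsetD[OF nu_extensive[OF domC] imageI[OF a]])
  then obtain F where F: "finite F" "F \<subseteq> Q <#> P" "pairwise_compatible F" "is_sup (a\<^sup>\<star>) F" by (rule nuE)
  have FC: "F \<subseteq> carrier S" using F(2) QPC by (rule order_trans)
  have ai: "a\<^sup>\<dagger> \<in> carrier S" using PC[OF a] by simp
  have "is_sup (a\<^sup>\<star> \<otimes> a\<^sup>\<dagger>) ((\<lambda>f. f \<otimes> a\<^sup>\<dagger>) ` F)" by (rule finite_join_mult(2)[OF F(4,1) FC F(3) ai])
  moreover have "a\<^sup>\<star> \<otimes> a\<^sup>\<dagger> = a\<^sup>\<dagger>" using PC[OF a] by (simp add: m_assoc)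
  moreover have "(\<lambda>f. f \<otimes> a\<^sup>\<dagger>) ` F \<subseteq> Q"
  proof (intro image_subsetI)
    fix f assume "f \<in> F"
    then have "f \<in> Q <#> P" using F(2) by auto
    then obtain q p where qp: "q \<in> Q" "p \<in> P" "f = q \<otimes> p" by (elim set_multE)
    have pa: "p \<otimes> a\<^sup>\<dagger> \<in> E" using acceptable_left_compatible[OF accP qp(2) a] .
    have "q \<otimes> (p \<otimes> a\<^sup>\<dagger>) \<in> Q"
      using below_mult_idem(1)[OF QC[OF qp(1)] pa] QC[OF qp(1)] pa by (intro acceptable_down[OF accQ qp(1)]) auto
    then show "f \<otimes> a\<^sup>\<dagger> \<in> Q" using QC[OF qp(1)] PC[OF qp(2)] ai by (simp add: qp m_assoc)
  qed
  moreover have "pairwise_compatible ((\<lambda>f. f \<otimes> a\<^sup>\<dagger>) ` F)"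
    using F(3) FC ai by (auto intro!: compatible_mult(1))
  ultimately have "a\<^sup>\<dagger> \<in> nu S Q" using F(1) by (metis finite_imageI nuI)
  then have "a\<^sup>\<dagger> \<in> Q" by (simp only: nu_setsD(2)[OF Q])
  then have "a\<^sup>\<dagger> \<otimes> b \<in> nu S (Q <#> P)" using b by (intro subsetD[OF nu_extensive[OF QPC]] set_multI)
  also have "\<dots> \<subseteq> E" unfolding QP using acceptable_carrier[OF accP] by (intro nu_idems domains_idems)
  finally have "a\<^sup>\<dagger> \<otimes> b \<in> E" .
  then show "compatible S a b"
    using acceptable_left_compatible[OF accP a b] unfolding compatible_iff by simp
qed

lemma partial_units_generated: "partial_units (R_nu_on \<G>) = (\<lambda>a. down {a}) ` carrier S"
proof
  show "partial_units (R_nu_on \<G>) \<subseteq> (\<lambda>a. down {a}) ` carrier S"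
  proof
    fix P assume "P \<in> partial_units (R_nu_on \<G>)"
    then obtain Q where P: "P \<in> \<G>" and Q: "Q \<in> \<G>" and QP: "nu S (Q <#> P) = nu S (domains P)"
      unfolding partial_units_def by auto
    note N = subsetD[OF generated_subset]
    obtain a where a: "a \<in> P" "P = down {a}"
      using compatible_generated_principal[OF P partial_unit_compatible[OF N[OF P] N[OF Q] QP]] .
    then have "a \<in> carrier S" using acceptable_carrier[OF nu_setsD(1)[OF N[OF P]]] by (metis subsetD)
    then show "P \<in> (\<lambda>a. down {a}) ` carrier S" unfolding a(2) by (rule imageI)
  qed
  show "(\<lambda>a. down {a}) ` carrier S \<subseteq> partial_units (R_nu_on \<G>)"
  proof (intro image_subsetI)
    fix a assume a: "a \<in> carrier S"
    then have "down {a} \<in> \<G>" "down {a\<^sup>\<dagger>} \<in> \<G>" by (simp_all add: finitely_generated_singleton)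
    moreover have "nu S (down {a\<^sup>\<dagger>} <#> down {a}) = nu S (domains (down {a}))"
      "nu S (down {a} <#> down {a\<^sup>\<dagger>}) = nu S (domains (down {a\<^sup>\<dagger>}))"
      using a by (simp_all add: down_singleton_mult down_singleton_star)
    ultimately show "down {a} \<in> partial_units (R_nu_on \<G>)"
      unfolding partial_units_def R_nu_on_simps by blast
  qed
qed

lemma generated_etale: "etale_boolean_right_restriction_monoid (R_nu_on \<G>)"
proof -
  interpret M: boolean_right_restriction_monoid "R_nu_on \<G>" by (rule generated_boolean)
  show ?thesis
  proof
    fix A assume "A \<in> carrier (R_nu_on \<G>)"
    then have A: "finitely_generated A" by simp
    then obtain F where F: "finite F" "F \<subseteq> carrier S" "A = nu S (down F)" by (rule finitely_generatedE)
    let ?X = "(\<lambda>f. down {f}) ` F"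
    have X: "?X \<subseteq> partial_units (R_nu_on \<G>)" unfolding partial_units_generated using F(2) by (rule image_mono)
    have "?X \<subseteq> \<G>" using F(2) finitely_generated_singleton by auto
    moreover have UX: "\<Union>?X = down F" by (auto simp: down_def)
    ultimately have "is_join (R_nu_on \<G>) (nu S (\<Union>?X)) ?X"
      using A F(3) by (intro nu_Union_is_join[OF generated_subset]) simp_all
    then have "is_join (R_nu_on \<G>) A ?X" by (simp only: UX F(3))
    then show "\<exists>X. finite X \<and> X \<subseteq> partial_units (R_nu_on \<G>) \<and> is_join (R_nu_on \<G>) A X"
      using X F(1) by (intro exI[of _ ?X] conjI finite_imageI)
  qed
qed

lemma iso_partial_units: "S \<cong> Inv (R_nu_on \<G>)"
proof (rule is_isoI)
  have "bij_betw (\<lambda>a. down {a}) (carrier S) (carrier (Inv (R_nu_on \<G>)))"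
    using down_singleton_inj by (simp add: Inv_def partial_units_generated bij_betw_def)
  moreover have "(\<lambda>a. down {a}) \<in> hom S (Inv (R_nu_on \<G>))"
    by (rule homI) (simp_all add: Inv_def partial_units_generated down_singleton_mult)
  ultimately show "(\<lambda>a. down {a}) \<in> iso S (Inv (R_nu_on \<G>))" by (simp add: iso_def)
qed

end

theorem theorem5p8:
  fixes S :: "('a, 'm) monoid_scheme"
  assumes "boolean_inverse_monoid S"
  shows "etale_boolean_right_restriction_monoid (Etale S) \<and> S \<cong> Inv (Etale S)"
proof -
  interpret boolean_inverse_monoid S by (rule assms)
  show ?thesis unfolding Etale_eq_R_nu_on using generated_etale iso_partial_units by simp
qed

end
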